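(* Let $a>0$ be a real number and $k\ge 1$ an integer. For integers $d_1\ge k$, $d_2\ge k$ and $t\ge1$, the covariance between the numbers $R(d_1,t)$ and $R(d_2,t)$ of nodes of degree $d_1$ and $d_2$, respectively, in the random graph $H_{a,k}^{(t)}$ satisfies $$ \operatorname{cov}(R(d_1,t),R(d_2,t))=O_{a,k}\left(\left(d_1^{-2-a}+d_2^{-2-a}\right)t+d_1^{-1}d_2^{-1}\right). $$
   Context: The Buckley--Osthus random graph. Fix a real number $a>0$ and an integer $k\ge1$ (constants). Graphs are undirected, and loops and multiple edges are allowed; a loop contributes $2$ to the degree of its node. First stage: the random graph $H_{a,1}^{(t)}$ has nodes $1,\dots,t$ and $t$ edges. $H_{a,1}^{(1)}$ is the graph with one node and one loop. For $t\ge2$, $H_{a,1}^{(t)}$ is obtained from $H_{a,1}^{(t-1)}$ by adding a new node $t$ and one new edge between $t$ and a random node $\gamma\in\{1,\dots,t\}$, where, conditionally on the graph $H_{a,1}^{(t-1)}$, $$\Pr(\gamma=s)=\frac{\deg_{t-1}(s)-1+a}{(a+1)t-1}\ \text{ for } 1\le s\le t-1,\qquad \Pr(\gamma=t)=\frac{a}{(a+1)t-1},$$ and $\deg_{t-1}(s)$ is the degree of $s$ in $H_{a,1}^{(t-1)}$. Second stage: $H_{a,k}^{(t)}$ is obtained from $H_{a,1}^{(kt)}$ by identifying the nodes $1,\dots,k$ into one node, the nodes $k+1,\dots,2k$ into a second node, and so on, which gives $t$ nodes; all $kt$ edges are kept (possibly becoming multiple edges and multiple loops). $R(d,t)$ is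 the number of nodes of degree $d$ in $H_{a,k}^{(t)}$. $O_{a,k}(\cdot)$ denotes a quantity bounded in absolute value by a constant depending only on $a$ and $k$ times the argument, uniformly over all $d_1,d_2\ge k$ and $t\ge1$. *)

theory Defs
  imports "HOL-Probability.Probability" "HOL-Library.Multiset"
begin

text \<open>
  A multigraph is given by its multiset of edges, an edge being the multiset of its two
  endpoints (so a loop at \<open>v\<close> is \<open>{#v, v#}\<close>, which makes it count twice in
  the degree of \<open>v\<close>).  The node set is not stored: a graph on \<open>t\<close> nodes has node
  set \<open>{1..t}\<close>.
\<close>

type_synonym mgraph = "nat multiset multiset"

definition node_degree :: "mgraph \<Rightarrow> nat \<Rightarrow> nat" where
  "node_degree G v = (\<Sum>e\<in>#G. count e v)"

definition attach_prob :: "real \<Rightarrow> nat \<Rightarrow> mgraph \<Rightarrow> nat \<Rightarrow> real" where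
  "attach_prob a t G s =
    (if 1 \<le> s \<and> s < t then (real (node_degree G s) - 1 + a) / ((a + 1) * real t - 1)
     else if s = t then a / ((a + 1) * real t - 1)
     else 0)"

text \<open>
  The numbers \<open>attach_prob a t G s\<close> form a probability distribution for every graph
  \<open>G\<close> to which the definition is applied below; see \<open>pmf_attach_pmf\<close>.
\<close>

definition attach_pmf :: "real \<Rightarrow> nat \<Rightarrow> mgraph \<Rightarrow> nat pmf" where
  "attach_pmf a t G = embed_pmf (attach_prob a t G)"

text \<open>The value at \<open>0\<close> is a dummy.\<close>

fun bo_graph1 :: "real \<Rightarrow> nat \<Rightarrow> mgraph pmf" where
  "bo_graph1 a 0 = return_pmf {#}"
| "bo_graph1 a (Suc 0) = return_pmf {#{#1, 1#}#}"
| "bo_graph1 a (Suc (Suc n)) =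
     (let t = Suc (Suc n) in
       bind_pmf (bo_graph1 a (Suc n))
         (\<lambda>G. map_pmf (\<lambda>s. add_mset {#t, s#} G) (attach_pmf a t G)))"

definition merge_nodes :: "nat \<Rightarrow> mgraph \<Rightarrow> mgraph" where
  "merge_nodes k G = image_mset (image_mset (\<lambda>i. (i - 1) div k + 1)) G"

definition bo_graph :: "real \<Rightarrow> nat \<Rightarrow> nat \<Rightarrow> mgraph pmf" where
  "bo_graph a k t = map_pmf (merge_nodes k) (bo_graph1 a (k * t))"

definition num_degree :: "nat \<Rightarrow> nat \<Rightarrow> mgraph \<Rightarrow> nat" where
  "num_degree d t G = card {v \<in> {1..t}. node_degree G v = d}"

definition covariance :: "'a measure \<Rightarrow> ('a \<Rightarrow> real) \<Rightarrow> ('a \<Rightarrow> real) \<Rightarrow> real" where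
  "covariance M X Y =
    (\<integral>\<omega>. (X \<omega> - (\<integral>\<eta>. X \<eta> \<partial>M)) * (Y \<omega> - (\<integral>\<eta>. Y \<eta> \<partial>M)) \<partial>M)"


subsection \<open>Well-definedness\<close>

definition wf_mgraph :: "nat \<Rightarrow> mgraph \<Rightarrow> bool" where
  "wf_mgraph t G \<longleftrightarrow> size G = t \<and> (\<forall>e\<in>#G. size e = 2 \<and> set_mset e \<subseteq> {1..t}) \<and>
    (\<forall>v\<in>{1..t}. node_degree G v \<ge> 1)"

lemma node_degree_add_mset [simp]: "node_degree (add_mset e G) v = count e v + node_degree G v"
  by (simp add: node_degree_def)

lemma sum_count_eq_size:
  assumes "set_mset e \<subseteq> {1..t::nat}"
  shows "(\<Sum>v\<in>{1..t}. count e v) = size e"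
  unfolding size_multiset_overloaded_eq
  using assms by (intro sum.mono_neutral_right) (auto simp: not_in_iff)

lemma sum_node_degree:
  assumes "\<forall>e\<in>#G. size e = 2 \<and> set_mset e \<subseteq> {1..t}"
  shows "(\<Sum>v\<in>{1..t}. node_degree G v) = 2 * size G"
  using assms
proof (induction G)
  case empty
  then show ?case by (simp add: node_degree_def)
next
  case (add e G)
  have "(\<Sum>v\<in>{1..t}. node_degree (add_mset e G) v) = (\<Sum>v\<in>{1..t}. count e v) + (\<Sum>v\<in>{1..t}. node_degree G v)"
    by (simp add: sum.distrib)
  also have "(\<Sum>v\<in>{1..t}. count e v) = 2"
    using add.prems by (subst sum_count_eq_size) auto
  finally show ?case using add by simp
qed

lemma attach_prob_nonneg:
  assumes "a > 0" "wf_mgraph n G"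
  shows "attach_prob a (Suc n) G s \<ge> 0"
proof -
  have "(a + 1) * real (Suc n) - 1 \<ge> 0"
    using assms(1) by (simp add: algebra_simps)
  moreover have "real (node_degree G s) - 1 + a \<ge> 0" if "1 \<le> s" "s < Suc n"
    using assms that by (force simp: wf_mgraph_def)
  ultimately show ?thesis
    using assms(1) by (auto simp: attach_prob_def intro!: divide_nonneg_nonneg)
qed

lemma sum_attach_prob:
  assumes "a > 0" "wf_mgraph n G"
  shows "(\<Sum>s\<in>{1..Suc n}. attach_prob a (Suc n) G s) = 1"
proof -
  let ?D = "(a + 1) * real (Suc n) - 1"
  have pos: "?D > 0"
    using assms(1) by (simp add: algebra_simps add_pos_nonneg)
  have "(\<Sum>s\<in>{1..n}. real (node_degree G s)) = real (\<Sum>s\<in>{1..n}. node_degree G s)"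
    by simp
  also have "\<dots> = 2 * real n"
    using assms(2) sum_node_degree[of G n] by (simp add: wf_mgraph_def)
  finally have deg: "(\<Sum>s\<in>{1..n}. real (node_degree G s) - 1 + a) = ?D - a"
    by (simp add: sum.distrib sum_subtractf algebra_simps)
  have "(\<Sum>s\<in>{1..Suc n}. attach_prob a (Suc n) G s) =
        (\<Sum>s\<in>{1..n}. (real (node_degree G s) - 1 + a) / ?D) + a / ?D"
    by (simp add: attach_prob_def)
  also have "\<dots> = (?D - a) / ?D + a / ?D"
    by (simp only: deg flip: sum_divide_distrib)
  also have "\<dots> = 1"
    using pos by (simp flip: add_divide_distrib)
  finally show ?thesis .
qed

lemma pmf_attach_pmf_aux:
  assumes "a > 0" "wf_mgraph n G"
  shows "pmf (attach_pmf a (Suc n) G) s = attach_prob a (Suc n) G s"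
  unfolding attach_pmf_def
proof (rule pmf_embed_pmf)
  show "0 \<le> attach_prob a (Suc n) G x" for x
    using assms by (rule attach_prob_nonneg)
  have "(\<integral>\<^sup>+x. ennreal (attach_prob a (Suc n) G x) \<partial>count_space UNIV) =
        (\<Sum>x\<in>{1..Suc n}. ennreal (attach_prob a (Suc n) G x))"
    by (rule nn_integral_count_space') (auto simp: attach_prob_def)
  also have "\<dots> = ennreal (\<Sum>x\<in>{1..Suc n}. attach_prob a (Suc n) G x)"
    by (rule sum_ennreal) (rule attach_prob_nonneg[OF assms])
  finally show "(\<integral>\<^sup>+x. ennreal (attach_prob a (Suc n) G x) \<partial>count_space UNIV) = 1"
    by (simp only: sum_attach_prob[OF assms] ennreal_1)
qed

lemma set_attach_pmf:
  assumes "a > 0" "wf_mgraph n G"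
  shows "set_pmf (attach_pmf a (Suc n) G) \<subseteq> {1..Suc n}"
  by (auto simp: set_pmf_eq pmf_attach_pmf_aux[OF assms] attach_prob_def split: if_splits)

lemma wf_mgraph_add:
  assumes "wf_mgraph n G" "s \<in> {1..Suc n}"
  shows "wf_mgraph (Suc n) (add_mset {#Suc n, s#} G)"
  unfolding wf_mgraph_def
proof (intro conjI ballI)
  show "size (add_mset {#Suc n, s#} G) = Suc n"
    using assms(1) by (simp add: wf_mgraph_def)
next
  fix e assume "e \<in># add_mset {#Suc n, s#} G"
  then consider "e = {#Suc n, s#}" | "e \<in># G" by auto
  then have "size e = 2 \<and> set_mset e \<subseteq> {1..Suc n}"
  proof cases
    case 1
    then show ?thesis using assms(2) by simp
  next
    case 2
    then have "size e = 2" "set_mset e \<subseteq> {1..n}"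
      using assms(1) by (simp_all add: wf_mgraph_def)
    moreover have "{1..n} \<subseteq> {1..Suc n}" by simp
    ultimately show ?thesis by blast
  qed
  then show "size e = 2" "set_mset e \<subseteq> {1..Suc n}" by blast+
next
  fix v assume v: "v \<in> {1..Suc n}"
  show "1 \<le> node_degree (add_mset {#Suc n, s#} G) v"
  proof (cases "v = Suc n")
    case True
    then show ?thesis by simp
  next
    case False
    then have "v \<in> {1..n}" using v by simp
    then have "1 \<le> node_degree G v" using assms(1) unfolding wf_mgraph_def by blast
    then show ?thesis by simp
  qed
qed

lemma wf_bo_graph1:
  assumes "a > 0" "t \<ge> 1" "G \<in> set_pmf (bo_graph1 a t)"
  shows "wf_mgraph t G"
  using assms
proof (induction a t arbitrary: G rule: bo_graph1.induct)
  case (2 a)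
  then show ?case by (simp add: wf_mgraph_def node_degree_def)
next
  case (3 a n)
  then obtain G' s where G': "G' \<in> set_pmf (bo_graph1 a (Suc n))"
    and s: "s \<in> set_pmf (attach_pmf a (Suc (Suc n)) G')"
    and G: "G = add_mset {#Suc (Suc n), s#} G'"
    by (auto simp: Let_def)
  have "wf_mgraph (Suc n) G'"
    using 3 G' by simp
  then show ?case
    using wf_mgraph_add set_attach_pmf[OF 3(2)] s unfolding G by blast
qed simp

lemma pmf_attach_pmf:
  assumes "a > 0" "t \<ge> 2" "G \<in> set_pmf (bo_graph1 a (t - 1))"
  shows "pmf (attach_pmf a t G) s = attach_prob a t G s"
  using pmf_attach_pmf_aux[of a "t - 1" G s] wf_bo_graph1[of a "t - 1" G] assms by simp

lemma finite_set_bo_graph1: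
  assumes "a > 0"
  shows "finite (set_pmf (bo_graph1 a t))"
  using assms
proof (induction a t rule: bo_graph1.induct)
  case (3 a n)
  have "finite (set_pmf (attach_pmf a (Suc (Suc n)) G))" if "G \<in> set_pmf (bo_graph1 a (Suc n))" for G
    by (rule finite_subset[OF set_attach_pmf]) (use 3 that wf_bo_graph1 in auto)
  then show ?case
    using 3 by (simp add: Let_def)
qed simp_all

lemma finite_set_bo_graph:
  assumes "a > 0"
  shows "finite (set_pmf (bo_graph a k t))"
  using finite_set_bo_graph1[OF assms] by (simp add: bo_graph_def)

end

theory Submission
  imports Defs
begin

text \<open>
  Let \<open>u\<close> and \<open>v\<close> be two distinct nodes of the merged graph, and let \<open>n\<close> be the number
  of nodes of the unmerged process. Since at most one of two complete nodes gains an edge per step,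
  the covariances of the events \<open>deg u = d1\<close> and \<open>deg v = d2\<close> satisfy a linear recursion in
  \<open>n\<close> whose coefficients are nonnegative on the reachable degrees, up to the product of the
  one-step changes of the two marginal probabilities. Taking absolute values and summing over all
  pairs, the claim follows from a supersolution. With \<open>N n = (a + 1) * n + a\<close>, the solution
  \<open>h\<close> of \<open>(d - k + k * a + 1 + a) * h d = (d - 1 - k + k * a) * h (d - 1)\<close>, which decays
  like \<open>d powr (- 2 - a)\<close>, makes \<open>N n * h d\<close> a supersolution for the mean number of nodes of
  degree \<open>d\<close> and \<open>N n * (h d1 + h d2)\<close> one for the covariances. The crude bound
  \<open>(d1 * h d1) * (d2 * h d2) = O(h d1 + h d2)\<close> suffices for the source term, and a newly created
  node has degree \<open>k\<close> up to an event of probability \<open>O(1 / n)\<close>, so that it contributes \<open>O(1)\<close>.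
\<close>

subsection \<open>Degrees in the merged graph\<close>

definition grp :: "nat \<Rightarrow> nat \<Rightarrow> nat" where
  "grp k i = (i - 1) div k + 1"

definition gdeg :: "nat \<Rightarrow> mgraph \<Rightarrow> nat \<Rightarrow> nat" where
  "gdeg k G v = node_degree (merge_nodes k G) v"

text \<open>Node \<open>v\<close> is complete once this value is \<open>k\<close>; while
  \<open>v\<close> is still being filled, the value serves as the lower bound for its
  degree.\<close>

definition gsize :: "nat \<Rightarrow> nat \<Rightarrow> nat \<Rightarrow> nat" where
  "gsize k n v = card {s\<in>{1..n}. grp k s = v}"

lemma gdeg_empty [simp]: "gdeg k {#} v = 0"
  by (simp add: gdeg_def merge_nodes_def node_degree_def)

lemma gdeg_add_mset:
  "gdeg k (add_mset e G) v = count (image_mset (grp k) e) v + gdeg k G v"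
  by (simp add: gdeg_def merge_nodes_def grp_def[abs_def])

lemma gdeg_add_edge [simp]:
  "gdeg k (add_mset {#i, j#} G) v =
    (of_bool (grp k i = v) + of_bool (grp k j = v)) + gdeg k G v"
  by (simp add: gdeg_add_mset)

lemma gdeg_eq_sum:
  assumes "\<forall>e\<in>#G. set_mset e \<subseteq> {1..n}"
  shows "gdeg k G v = (\<Sum>s | s \<in> {1..n} \<and> grp k s = v. node_degree G s)"
  using assms
proof (induction G)
  case empty
  then show ?case by (simp add: node_degree_def)
next
  case (add e G)
  have "count (image_mset (grp k) e) v = (\<Sum>s\<in>grp k -` {v} \<inter> set_mset e. count e s)"
    by (simp add: count_image_mset)
  also have "\<dots> = (\<Sum>s | s \<in> {1..n} \<and> grp k s = v. count e s)"
    using add.prems by (intro sum.mono_neutral_left) (auto simp: not_in_iff)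
  finally show ?case
    using add by (simp add: gdeg_add_mset sum.distrib)
qed

lemma wf_mgraph_imp_edges: "wf_mgraph n G \<Longrightarrow> \<forall>e\<in>#G. set_mset e \<subseteq> {1..n}"
  by (simp add: wf_mgraph_def)

text \<open>The attachment weights involve degree minus 1 of each unmerged node, so after merging
  the degree enters through its excess over \<open>gsize\<close>.\<close>

lemma gdeg_excess:
  assumes "wf_mgraph n G"
  shows "real (gdeg k G v) - real (gsize k n v) =
    (\<Sum>s | s \<in> {1..n} \<and> grp k s = v. real (node_degree G s) - 1)"
  by (simp add: gdeg_eq_sum[OF wf_mgraph_imp_edges[OF assms]] gsize_def sum_subtractf)

lemma gsize_le_gdeg:
  assumes "wf_mgraph n G"
  shows "gsize k n v \<le> gdeg k G v"
proof -
  have "(\<Sum>s | s \<in> {1..n} \<and> grp k s = v. real (node_degree G s) - 1) \<ge> 0"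
    using assms by (intro sum_nonneg) (fastforce simp: wf_mgraph_def)
  then show ?thesis
    unfolding gdeg_excess[OF assms, symmetric] by simp
qed

text \<open>Distinct merged nodes have disjoint fibres and every summand is nonnegative, so the
  total excess \<open>2 * n - n\<close> is an upper bound. This limits which degrees, and which
  pairs of degrees, can occur at time \<open>n\<close>.\<close>

lemma sum_gdeg_excess_le:
  assumes "wf_mgraph n G" "finite V"
  shows "(\<Sum>v\<in>V. real (gdeg k G v) - real (gsize k n v)) \<le> real n"
proof -
  have "(\<Sum>v\<in>V. real (gdeg k G v) - real (gsize k n v)) =
      (\<Sum>v\<in>V. \<Sum>s | s \<in> {1..n} \<and> grp k s = v. real (node_degree G s) - 1)"
    by (simp only: gdeg_excess[OF assms(1)])
  also have "\<dots> = (\<Sum>s\<in>(\<Union>v\<in>V. {s\<in>{1..n}. grp k s = v}). real (node_degree G s) - 1)"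
    using assms(2) by (intro sum.UNION_disjoint[symmetric]) auto
  also have "\<dots> \<le> (\<Sum>s\<in>{1..n}. real (node_degree G s) - 1)"
    using assms by (intro sum_mono2) (fastforce simp: wf_mgraph_def)+
  also have "\<dots> = real (\<Sum>s\<in>{1..n}. node_degree G s) - real n"
    by (simp add: sum_subtractf)
  also have "\<dots> = real n"
    using assms(1) sum_node_degree[of G n] by (simp add: wf_mgraph_def)
  finally show ?thesis .
qed

lemma grp_eq_iff:
  assumes "k \<ge> 1" "s \<ge> 1" "v \<ge> 1"
  shows "grp k s = v \<longleftrightarrow> k * (v - 1) < s \<and> s \<le> k * v"
proof -
  obtain r where r: "s = Suc r" using assms by (cases s) auto
  obtain u where u: "v = Suc u" using assms by (cases v) auto
  have "r div k = u \<longleftrightarrow> k * u \<le> r \<and> r < k * Suc u"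
    using assms(1) div_nat_eqI[of k u r] dividend_less_times_div[of k r]
      times_div_less_eq_dividend[of k r] by (auto simp: mult.commute)
  then show ?thesis by (auto simp: r u grp_def less_Suc_eq_le)
qed

lemma gsize_eq:
  assumes "k \<ge> 1" "v \<ge> 1"
  shows "gsize k n v = min n (k * v) - k * (v - 1)"
proof -
  have "{s\<in>{1..n}. k * (v - 1) < s \<and> s \<le> k * v} = {k * (v - 1)<..min n (k * v)}"
    using assms(2) by auto
  moreover have "{s\<in>{1..n}. grp k s = v} = {s\<in>{1..n}. k * (v - 1) < s \<and> s \<le> k * v}"
    using assms by (intro Collect_cong conj_cong refl grp_eq_iff) auto
  ultimately show ?thesis by (simp add: gsize_def)
qed

lemma gsize_complete:
  assumes "k \<ge> 1" "v \<in> {1..n div k}"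
  shows "gsize k n v = k"
proof -
  have "k * v \<le> n"
    using assms by (metis atLeastAtMost_iff less_eq_div_iff_mult_less_eq mult.commute not_less_eq_eq One_nat_def Suc_le_eq)
  then show ?thesis
    using assms by (simp add: gsize_eq min_def right_diff_distrib')
qed

lemma grp_Suc:
  assumes "k \<ge> 1"
  shows "grp k (Suc n) = Suc (n div k)"
  by (simp add: grp_def)

text \<open>Only edges created after step \<open>k * (v - 1)\<close> can touch node
  \<open>v\<close>, and each contributes at most 2. For earlier \<open>n\<close> the truncated
  subtraction yields degree 0.\<close>

lemma gdeg_le_twice:
  assumes "a > 0" "k \<ge> 1" "v \<ge> 1" "n \<ge> 1" "G \<in> set_pmf (bo_graph1 a n)"
  shows "gdeg k G v \<le> 2 * (n - k * (v - 1))"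
  using assms(4,5)
proof (induction n arbitrary: G rule: nat_induct_at_least)
  case base
  then show ?case
    using assms by (auto simp: grp_eq_iff of_bool_def)
next
  case (Suc n)
  then obtain m where m: "n = Suc m" by (cases n) auto
  obtain G' s where G': "G' \<in> set_pmf (bo_graph1 a n)"
    and s: "s \<in> set_pmf (attach_pmf a (Suc n) G')"
    and G: "G = add_mset {#Suc n, s#} G'"
    using Suc.prems unfolding m by (auto simp: Let_def)
  have "s \<in> {1..Suc n}"
    using set_attach_pmf[OF assms(1) wf_bo_graph1[OF assms(1) Suc.hyps G']] s by blast
  then show ?case
    using Suc.IH[OF G'] assms unfolding G by (auto simp: grp_eq_iff of_bool_def)
qed

section \<open>One-step attachment probabilities of merged nodes\<close>

definition pdenom :: "real \<Rightarrow> nat \<Rightarrow> real" where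
  "pdenom a n = (a + 1) * real n + a"

lemma pdenom_pos: "a > 0 \<Longrightarrow> pdenom a n > 0"
  by (simp add: pdenom_def add_nonneg_pos)

text \<open>The shift \<open>a\<close> is counted with the group size at time \<open>Suc n\<close>,
  because the arriving node may attach to itself. The formula thus also covers the node being
  filled. The denominator is the normalising constant \<open>(a + 1) * (n + 1) - 1\<close>.\<close>

lemma sum_attach_prob_grp:
  assumes "a > 0" "wf_mgraph n G"
  shows "(\<Sum>s\<in>{1..Suc n}. attach_prob a (Suc n) G s * of_bool (grp k s = v)) =
    (real (gdeg k G v) - real (gsize k n v) + a * real (gsize k (Suc n) v)) / pdenom a n"
proof -
  have den: "(a + 1) * real (Suc n) - 1 = pdenom a n"
    by (simp add: pdenom_def algebra_simps)
  have size: "real (gsize k m v) = (\<Sum>s\<in>{1..m}. of_bool (grp k s = v))" for m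
    unfolding gsize_def of_bool_def by (subst sum.inter_filter[symmetric]) simp_all
  have "(\<Sum>s\<in>{1..Suc n}. attach_prob a (Suc n) G s * of_bool (grp k s = v)) =
      (\<Sum>s\<in>{1..n}. (real (node_degree G s) - 1 + a) / pdenom a n * of_bool (grp k s = v))
      + a / pdenom a n * of_bool (grp k (Suc n) = v)"
    by (simp add: attach_prob_def den del: of_nat_Suc)
  also have "\<dots> = ((\<Sum>s\<in>{1..n}. (real (node_degree G s) - 1) * of_bool (grp k s = v))
      + a * (\<Sum>s\<in>{1..Suc n}. of_bool (grp k s = v))) / pdenom a n"
    by (simp add: add_divide_distrib sum_divide_distrib sum_distrib_left algebra_simps
        diff_divide_distrib sum.distrib sum_subtractf
        del: sum_of_bool_eq sum_mult_of_bool_eq sum_of_bool_mult_eq)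
  also have "(\<Sum>s\<in>{1..n}. (real (node_degree G s) - 1) * of_bool (grp k s = v)) =
      (\<Sum>s | s \<in> {1..n} \<and> grp k s = v. real (node_degree G s) - 1)"
    by (intro sum.mono_neutral_cong_right) auto
  finally show ?thesis
    by (simp only: size[symmetric] gdeg_excess[OF assms(2)])
qed

lemma expectation_bo_graph1_Suc:
  fixes \<phi> :: "mgraph \<Rightarrow> real"
  assumes "a > 0" "n \<ge> 1"
  shows "measure_pmf.expectation (bo_graph1 a (Suc n)) \<phi> =
    measure_pmf.expectation (bo_graph1 a n)
      (\<lambda>G. \<Sum>s\<in>{1..Suc n}. attach_prob a (Suc n) G s * \<phi> (add_mset {#Suc n, s#} G))"
    (is "_ = measure_pmf.expectation _ ?\<psi>")
proof -
  obtain m where m: "n = Suc m" using assms(2) by (cases n) auto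
  let ?A = "set_pmf (bo_graph1 a n)"
  have fin: "finite ?A" using finite_set_bo_graph1[OF assms(1)] .
  have wf: "wf_mgraph n G" if "G \<in> ?A" for G
    using wf_bo_graph1[OF assms that] .
  have sub: "set_pmf (attach_pmf a (Suc n) G) \<subseteq> {1..Suc n}" if "G \<in> ?A" for G
    using set_attach_pmf[OF assms(1) wf[OF that]] .
  have inner: "measure_pmf.expectation
      (map_pmf (\<lambda>s. add_mset {#Suc n, s#} G) (attach_pmf a (Suc n) G)) \<phi> = ?\<psi> G"
    if "G \<in> ?A" for G
  proof -
    have "measure_pmf.expectation (attach_pmf a (Suc n) G) (\<lambda>s. \<phi> (add_mset {#Suc n, s#} G)) =
        (\<Sum>s\<in>{1..Suc n}. \<phi> (add_mset {#Suc n, s#} G) * pmf (attach_pmf a (Suc n) G) s)"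
      using sub[OF that] by (intro integral_measure_pmf_real) auto
    then show ?thesis
      by (simp add: pmf_attach_pmf_aux[OF assms(1) wf[OF that]] mult.commute)
  qed
  have "measure_pmf.expectation (bo_graph1 a (Suc n)) \<phi> = (\<Sum>G\<in>?A. pmf (bo_graph1 a n) G *
      measure_pmf.expectation (map_pmf (\<lambda>s. add_mset {#Suc n, s#} G) (attach_pmf a (Suc n) G)) \<phi>)"
    unfolding m bo_graph1.simps Let_def
    by (subst pmf_expectation_bind[OF fin[unfolded m]])
      (use finite_subset[OF sub] in \<open>auto simp: m\<close>)
  also have "\<dots> = (\<Sum>G\<in>?A. ?\<psi> G * pmf (bo_graph1 a n) G)"
    by (intro sum.cong refl) (simp only: inner mult.commute)
  also have "\<dots> = measure_pmf.expectation (bo_graph1 a n) ?\<psi>"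
    using fin by (intro integral_measure_pmf_real[symmetric]) auto
  finally show ?thesis .
qed

subsection \<open>Evolution of the degree probabilities and covariances\<close>

locale buckley_osthus =
  fixes a :: real and k :: nat
  assumes a_pos: "a > 0" and k_pos: "k \<ge> 1"
begin

abbreviation E :: "nat \<Rightarrow> (mgraph \<Rightarrow> real) \<Rightarrow> real" where
  "E n \<equiv> measure_pmf.expectation (bo_graph1 a n)"

abbreviation N :: "nat \<Rightarrow> real" where
  "N \<equiv> pdenom a"

text \<open>\<open>w d / N n\<close> is the probability that a complete node of degree \<open>d\<close> is chosen. A
  complete node has degree at least \<open>k\<close>; the value \<open>0\<close> below makes the recursions hold
  for \<open>d = k\<close> and \<open>d = 0\<close> as well.\<close>

definition w :: "nat \<Rightarrow> real" where
  "w d = (if d < k then 0 else real d - real k + real k * a)"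

definition deg_prob :: "nat \<Rightarrow> nat \<Rightarrow> nat \<Rightarrow> real" where
  "deg_prob n u d = E n (\<lambda>G. of_bool (gdeg k G u = d))"

definition deg_prob2 :: "nat \<Rightarrow> nat \<Rightarrow> nat \<Rightarrow> nat \<Rightarrow> nat \<Rightarrow> real" where
  "deg_prob2 n u v d1 d2 = E n (\<lambda>G. of_bool (gdeg k G u = d1) * of_bool (gdeg k G v = d2))"

definition deg_cov :: "nat \<Rightarrow> nat \<Rightarrow> nat \<Rightarrow> nat \<Rightarrow> nat \<Rightarrow> real" where
  "deg_cov n u v d1 d2 = deg_prob2 n u v d1 d2 - deg_prob n u d1 * deg_prob n v d2"

definition drift :: "nat \<Rightarrow> nat \<Rightarrow> nat \<Rightarrow> real" where
  "drift n u d = (w (d - 1) * deg_prob n u (d - 1) - w d * deg_prob n u d) / N n"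

lemma w_nonneg: "w d \<ge> 0"
  using a_pos by (simp add: w_def)

lemma w_0 [simp]: "w 0 = 0"
  using k_pos by (simp add: w_def)

lemma N_pos: "N n > 0"
  using a_pos by (rule pdenom_pos)

lemma integrable_E [simp]: "integrable (measure_pmf (bo_graph1 a n)) (f :: mgraph \<Rightarrow> real)"
  by (rule integrable_measure_pmf_finite) (rule finite_set_bo_graph1[OF a_pos])

lemma E_cong:
  assumes "\<And>G. G \<in> set_pmf (bo_graph1 a n) \<Longrightarrow> f G = g G"
  shows "E n f = E n g"
  by (rule integral_cong_AE) (use assms in \<open>auto simp: AE_measure_pmf_iff\<close>)

lemma E_mono:
  assumes "\<And>G. G \<in> set_pmf (bo_graph1 a n) \<Longrightarrow> f G \<le> g G"
  shows "E n f \<le> E n g"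
  by (rule integral_mono_AE) (use assms in \<open>auto simp: AE_measure_pmf_iff\<close>)

lemma w_gdeg:
  assumes "wf_mgraph n G" "u \<in> {1..n div k}"
  shows "(\<Sum>s\<in>{1..Suc n}. attach_prob a (Suc n) G s * of_bool (grp k s = u)) = w (gdeg k G u) / N n"
proof -
  have "u \<in> {1..Suc n div k}"
    using assms(2) order_trans[OF _ div_le_mono[of n "Suc n" k]] by simp
  then have "gsize k n u = k" "gsize k (Suc n) u = k"
    using assms(2) k_pos by (simp_all only: gsize_complete)
  then show ?thesis
    using gsize_le_gdeg[OF assms(1), of k u]
    by (simp only: sum_attach_prob_grp[OF a_pos assms(1)] w_def) (simp add: algebra_simps)
qed

text \<open>The arriving endpoint lies in the group being filled, hence in neither \<open>u\<close>
  nor \<open>v\<close>; the other endpoint lies in at most one of them. So at most one of the two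
  degrees grows, by exactly 1, and no joint increment appears.\<close>

lemma E_Suc_gdeg2:
  fixes \<phi> :: "nat \<Rightarrow> nat \<Rightarrow> real"
  assumes "n \<ge> 1" "u \<in> {1..n div k}" "v \<in> {1..n div k}" "u \<noteq> v"
  shows "E (Suc n) (\<lambda>G. \<phi> (gdeg k G u) (gdeg k G v)) =
    E n (\<lambda>G. \<phi> (gdeg k G u) (gdeg k G v) +
      w (gdeg k G u) / N n * (\<phi> (Suc (gdeg k G u)) (gdeg k G v) - \<phi> (gdeg k G u) (gdeg k G v)) +
      w (gdeg k G v) / N n * (\<phi> (gdeg k G u) (Suc (gdeg k G v)) - \<phi> (gdeg k G u) (gdeg k G v)))"
proof (subst expectation_bo_graph1_Suc[OF a_pos assms(1)], rule E_cong)
  fix G assume "G \<in> set_pmf (bo_graph1 a n)"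
  then have wf: "wf_mgraph n G"
    using wf_bo_graph1 a_pos assms(1) by blast
  let ?x = "gdeg k G u" and ?y = "gdeg k G v" and ?p = "attach_prob a (Suc n) G"
  let ?A = "\<phi> (Suc ?x) ?y - \<phi> ?x ?y" and ?B = "\<phi> ?x (Suc ?y) - \<phi> ?x ?y"
  have ne: "grp k (Suc n) \<noteq> u" "grp k (Suc n) \<noteq> v"
    using assms k_pos by (auto simp: grp_Suc)
  have "(\<Sum>s\<in>{1..Suc n}. ?p s * \<phi> (gdeg k (add_mset {#Suc n, s#} G) u) (gdeg k (add_mset {#Suc n, s#} G) v)) =
    (\<Sum>s\<in>{1..Suc n}. \<phi> ?x ?y * ?p s + ?A * (?p s * of_bool (grp k s = u)) + ?B * (?p s * of_bool (grp k s = v)))"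
    using assms(4) ne by (intro sum.cong refl) (auto simp: of_bool_def algebra_simps)
  also have "\<dots> = \<phi> ?x ?y * (\<Sum>s\<in>{1..Suc n}. ?p s)
      + ?A * (\<Sum>s\<in>{1..Suc n}. ?p s * of_bool (grp k s = u))
      + ?B * (\<Sum>s\<in>{1..Suc n}. ?p s * of_bool (grp k s = v))"
    by (simp only: sum.distrib sum_distrib_left)
  also have "\<dots> = \<phi> ?x ?y + w ?x / N n * ?A + w ?y / N n * ?B"
    by (simp only: w_gdeg[OF wf assms(2)] w_gdeg[OF wf assms(3)] sum_attach_prob[OF a_pos wf])
      (simp add: mult.commute)
  finally show "(\<Sum>s\<in>{1..Suc n}. ?p s * \<phi> (gdeg k (add_mset {#Suc n, s#} G) u) (gdeg k (add_mset {#Suc n, s#} G) v)) =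
    \<phi> ?x ?y + w ?x / N n * ?A + w ?y / N n * ?B" .
qed

lemma E_Suc_gdeg:
  fixes \<phi> :: "nat \<Rightarrow> real"
  assumes "n \<ge> 1" "u \<in> {1..n div k}"
  shows "E (Suc n) (\<lambda>G. \<phi> (gdeg k G u)) =
    E n (\<lambda>G. \<phi> (gdeg k G u) + w (gdeg k G u) / N n * (\<phi> (Suc (gdeg k G u)) - \<phi> (gdeg k G u)))"
proof (subst expectation_bo_graph1_Suc[OF a_pos assms(1)], rule E_cong)
  fix G assume "G \<in> set_pmf (bo_graph1 a n)"
  then have wf: "wf_mgraph n G"
    using wf_bo_graph1 a_pos assms(1) by blast
  let ?x = "gdeg k G u" and ?p = "attach_prob a (Suc n) G"
  let ?A = "\<phi> (Suc ?x) - \<phi> ?x"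
  have ne: "grp k (Suc n) \<noteq> u"
    using assms k_pos by (auto simp: grp_Suc)
  have "(\<Sum>s\<in>{1..Suc n}. ?p s * \<phi> (gdeg k (add_mset {#Suc n, s#} G) u)) =
    (\<Sum>s\<in>{1..Suc n}. \<phi> ?x * ?p s + ?A * (?p s * of_bool (grp k s = u)))"
    using ne by (intro sum.cong refl) (auto simp: of_bool_def algebra_simps)
  also have "\<dots> = \<phi> ?x * (\<Sum>s\<in>{1..Suc n}. ?p s)
      + ?A * (\<Sum>s\<in>{1..Suc n}. ?p s * of_bool (grp k s = u))"
    by (simp only: sum.distrib sum_distrib_left)
  also have "\<dots> = \<phi> ?x + w ?x / N n * ?A"
    by (simp only: w_gdeg[OF wf assms(2)] sum_attach_prob[OF a_pos wf])
      (simp add: mult.commute)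
  finally show "(\<Sum>s\<in>{1..Suc n}. ?p s * \<phi> (gdeg k (add_mset {#Suc n, s#} G) u)) =
    \<phi> ?x + w ?x / N n * ?A" .
qed

lemma w_of_bool: "w x * of_bool (x = d) = w d * of_bool (x = d)"
  by simp

text \<open>On the event the random weight is constant and can be taken out of the expectation. For
  \<open>d = 0\<close> both sides vanish, since \<open>0 - 1 = 0\<close> and
  \<open>w 0 = 0\<close>.\<close>

lemma w_of_bool_Suc: "w x * of_bool (Suc x = d) = w (d - 1) * of_bool (x = d - 1)"
  by (cases d) auto

lemma deg_prob_Suc:
  assumes "n \<ge> 1" "u \<in> {1..n div k}"
  shows "deg_prob (Suc n) u d = deg_prob n u d + drift n u d"
proof -
  have "deg_prob (Suc n) u d = E n (\<lambda>G. of_bool (gdeg k G u = d) +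
      (w (gdeg k G u) * of_bool (Suc (gdeg k G u) = d) - w (gdeg k G u) * of_bool (gdeg k G u = d)) / N n)"
    unfolding deg_prob_def
    by (subst E_Suc_gdeg[OF assms, where \<phi> = "\<lambda>x. of_bool (x = d)"])
      (simp add: right_diff_distrib diff_divide_distrib)
  also have "\<dots> = deg_prob n u d + drift n u d"
    unfolding w_of_bool w_of_bool_Suc by (simp add: deg_prob_def drift_def)
  finally show ?thesis .
qed

lemma deg_prob2_Suc:
  assumes "n \<ge> 1" "u \<in> {1..n div k}" "v \<in> {1..n div k}" "u \<noteq> v"
  shows "deg_prob2 (Suc n) u v d1 d2 = deg_prob2 n u v d1 d2
    + (w (d1 - 1) * deg_prob2 n u v (d1 - 1) d2 - w d1 * deg_prob2 n u v d1 d2) / N n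
    + (w (d2 - 1) * deg_prob2 n u v d1 (d2 - 1) - w d2 * deg_prob2 n u v d1 d2) / N n"
proof -
  have "deg_prob2 (Suc n) u v d1 d2 =
    E n (\<lambda>G. of_bool (gdeg k G u = d1) * of_bool (gdeg k G v = d2)
      + ((w (gdeg k G u) * of_bool (Suc (gdeg k G u) = d1)) * of_bool (gdeg k G v = d2)
         - (w (gdeg k G u) * of_bool (gdeg k G u = d1)) * of_bool (gdeg k G v = d2)) / N n
      + ((w (gdeg k G v) * of_bool (Suc (gdeg k G v) = d2)) * of_bool (gdeg k G u = d1)
         - (w (gdeg k G v) * of_bool (gdeg k G v = d2)) * of_bool (gdeg k G u = d1)) / N n)"
    unfolding deg_prob2_def
    by (subst E_Suc_gdeg2[OF assms, where \<phi> = "\<lambda>x y. of_bool (x = d1) * of_bool (y = d2)"])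
      (intro E_cong, auto simp: of_bool_def diff_divide_distrib)
  also have "\<dots> = E n (\<lambda>G. of_bool (gdeg k G u = d1) * of_bool (gdeg k G v = d2)
      + (w (d1 - 1) * (of_bool (gdeg k G u = d1 - 1) * of_bool (gdeg k G v = d2))
         - w d1 * (of_bool (gdeg k G u = d1) * of_bool (gdeg k G v = d2))) / N n
      + (w (d2 - 1) * (of_bool (gdeg k G u = d1) * of_bool (gdeg k G v = d2 - 1))
         - w d2 * (of_bool (gdeg k G u = d1) * of_bool (gdeg k G v = d2))) / N n)"
    unfolding w_of_bool w_of_bool_Suc by (simp only: mult_ac)
  also have "\<dots> = deg_prob2 n u v d1 d2
    + (w (d1 - 1) * deg_prob2 n u v (d1 - 1) d2 - w d1 * deg_prob2 n u v d1 d2) / N n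
    + (w (d2 - 1) * deg_prob2 n u v d1 (d2 - 1) - w d2 * deg_prob2 n u v d1 d2) / N n"
    by (simp add: deg_prob2_def)
  finally show ?thesis .
qed

text \<open>The product of the two updated marginals consists of the old product, two cross terms of
  the same linear form as the recursion of \<open>deg_prob2\<close>, and a product of drifts. After
  subtraction only the last one remains as a source term.\<close>

lemma deg_cov_Suc:
  assumes "n \<ge> 1" "u \<in> {1..n div k}" "v \<in> {1..n div k}" "u \<noteq> v"
  shows "deg_cov (Suc n) u v d1 d2 = (1 - (w d1 + w d2) / N n) * deg_cov n u v d1 d2
    + w (d1 - 1) / N n * deg_cov n u v (d1 - 1) d2
    + w (d2 - 1) / N n * deg_cov n u v d1 (d2 - 1)
    - drift n u d1 * drift n v d2"
proof -
  have drift1: "drift n u d1 * deg_prob n v d2 =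
      w (d1 - 1) / N n * (deg_prob n u (d1 - 1) * deg_prob n v d2)
      - w d1 / N n * (deg_prob n u d1 * deg_prob n v d2)"
    by (simp add: drift_def left_diff_distrib diff_divide_distrib)
  have drift2: "deg_prob n u d1 * drift n v d2 =
      w (d2 - 1) / N n * (deg_prob n u d1 * deg_prob n v (d2 - 1))
      - w d2 / N n * (deg_prob n u d1 * deg_prob n v d2)"
    by (simp add: drift_def right_diff_distrib diff_divide_distrib mult.left_commute)
  have "deg_prob (Suc n) u d1 * deg_prob (Suc n) v d2 = deg_prob n u d1 * deg_prob n v d2
      + drift n u d1 * deg_prob n v d2 + deg_prob n u d1 * drift n v d2 + drift n u d1 * drift n v d2"
    by (simp only: deg_prob_Suc[OF assms(1,2)] deg_prob_Suc[OF assms(1,3)] ring_distribs add.assoc)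
  then show ?thesis
    unfolding deg_cov_def deg_prob2_Suc[OF assms] drift1 drift2
    by (simp only: ring_distribs add_divide_distrib diff_divide_distrib) simp
qed

section \<open>Bounds for single probabilities and covariances\<close>

lemma deg_prob_nonneg: "deg_prob n u d \<ge> 0"
  by (simp add: deg_prob_def)

lemma deg_prob_le_1: "deg_prob n u d \<le> 1"
  using E_mono[of n "\<lambda>G. of_bool (gdeg k G u = d)" "\<lambda>_. 1"] by (simp add: deg_prob_def)

lemma deg_prob2_commute: "deg_prob2 n u v d1 d2 = deg_prob2 n v u d2 d1"
  by (simp add: deg_prob2_def mult.commute)

lemma deg_cov_commute: "deg_cov n u v d1 d2 = deg_cov n v u d2 d1"
  by (simp add: deg_cov_def deg_prob2_commute[of n u] mult.commute)

text \<open>With \<open>b\<close> the probability of the second event, the covariance is the mean of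
  \<open>A * (B - b)\<close>. Its absolute value is at most that of \<open>B - b\<close>, which
  equals \<open>(1 - 2 * b) * B + b\<close> for an indicator \<open>B\<close>. The bound is small
  for rare and for almost certain events alike, as required for newly completed nodes.\<close>

lemma abs_deg_cov_le: "\<bar>deg_cov n u v d1 d2\<bar> \<le> 2 * deg_prob n v d2 * (1 - deg_prob n v d2)"
proof -
  define b where "b = deg_prob n v d2"
  have b: "0 \<le> b" "b \<le> 1"
    unfolding b_def by (rule deg_prob_nonneg, rule deg_prob_le_1)
  define A B :: "mgraph \<Rightarrow> real"
    where "A = (\<lambda>G. of_bool (gdeg k G u = d1))" and "B = (\<lambda>G. of_bool (gdeg k G v = d2))"
  have AB: "A G = 0 \<or> A G = 1" "B G = 0 \<or> B G = 1" for G
    by (simp_all add: A_def B_def)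
  have "deg_cov n u v d1 d2 = E n (\<lambda>G. A G * B G) - b * E n A"
    by (simp only: deg_cov_def deg_prob2_def deg_prob_def[of n u] A_def B_def b_def mult.commute)
  also have "\<dots> = E n (\<lambda>G. A G * B G - b * A G)"
    by simp
  also have "\<bar>\<dots>\<bar> \<le> E n (\<lambda>G. \<bar>A G * B G - b * A G\<bar>)"
    by (rule integral_abs_bound)
  also have "\<dots> \<le> E n (\<lambda>G. (1 - 2 * b) * B G + b)"
  proof (rule E_mono)
    fix G
    show "\<bar>A G * B G - b * A G\<bar> \<le> (1 - 2 * b) * B G + b"
      using b by (cases "A G = 0"; cases "B G = 0") (use AB[of G] in auto)
  qed
  also have "\<dots> = (1 - 2 * b) * b + b"
    by (simp add: b_def deg_prob_def B_def)
  also have "\<dots> = 2 * b * (1 - b)"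
    by (simp add: algebra_simps)
  finally show ?thesis by (simp only: b_def)
qed

lemma abs_deg_cov_le_2: "\<bar>deg_cov n u v d1 d2\<bar> \<le> 2"
proof -
  have "deg_prob n v d2 * (1 - deg_prob n v d2) \<le> 1 * 1"
    using deg_prob_nonneg[of n v d2] deg_prob_le_1[of n v d2] by (intro mult_mono) auto
  then show ?thesis using abs_deg_cov_le[of n u v d1 d2] by simp
qed

lemma deg_prob_eq_0:
  assumes "\<And>G. G \<in> set_pmf (bo_graph1 a n) \<Longrightarrow> gdeg k G u \<noteq> d"
  shows "deg_prob n u d = 0"
proof -
  have "deg_prob n u d = E n (\<lambda>_. 0)"
    unfolding deg_prob_def using assms by (intro E_cong) auto
  then show ?thesis by simp
qed

lemma deg_prob2_eq_0:
  assumes "\<And>G. G \<in> set_pmf (bo_graph1 a n) \<Longrightarrow> gdeg k G u = d1 \<Longrightarrow> gdeg k G v \<noteq> d2"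
  shows "deg_prob2 n u v d1 d2 = 0"
proof -
  have "deg_prob2 n u v d1 d2 = E n (\<lambda>_. 0)"
    unfolding deg_prob2_def using assms by (intro E_cong) auto
  then show ?thesis by simp
qed

lemma deg_prob_eq_0_large:
  assumes "n \<ge> 1" "u \<in> {1..n div k}" "d > n + k"
  shows "deg_prob n u d = 0"
proof (rule deg_prob_eq_0)
  fix G assume "G \<in> set_pmf (bo_graph1 a n)"
  then have "wf_mgraph n G" using wf_bo_graph1 a_pos assms(1) by blast
  from sum_gdeg_excess_le[OF this, of "{u}" k] assms k_pos
  show "gdeg k G u \<noteq> d" by (auto simp: gsize_complete)
qed

text \<open>Two distinct complete nodes share a total excess of at most \<open>n\<close>, which is
  sharper than adding their separate bounds. This keeps \<open>w d1 + w d2\<close> below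
  \<open>N n\<close> for reachable pairs.\<close>

lemma deg_prob2_eq_0_large:
  assumes "n \<ge> 1" "u \<in> {1..n div k}" "v \<in> {1..n div k}" "u \<noteq> v" "d1 + d2 > n + 2 * k"
  shows "deg_prob2 n u v d1 d2 = 0"
proof (rule deg_prob2_eq_0)
  fix G assume "G \<in> set_pmf (bo_graph1 a n)" and "gdeg k G u = d1"
  then have "wf_mgraph n G" using wf_bo_graph1 a_pos assms(1) by blast
  from sum_gdeg_excess_le[OF this, of "{u, v}" k] assms k_pos \<open>gdeg k G u = d1\<close>
  show "gdeg k G v \<noteq> d2" by (auto simp: gsize_complete)
qed

text \<open>While node \<open>Suc t\<close> is being filled, each step gives it one degree from the
  arriving endpoint. Its degree differs from the number of steps only if some edge has both
  endpoints in it; a union bound over the steps controls this.\<close>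

lemma deg_prob_new:
  assumes "t \<ge> 1" "j \<le> k"
  shows "E (k * t + j) (\<lambda>G. of_bool (gdeg k G (Suc t) \<noteq> j)) \<le> real j * (real k * a / N (k * t))"
  using assms(2)
proof (induction j)
  case 0
  have n: "k * t \<ge> 1" using assms(1) k_pos by simp
  have "E (k * t) (\<lambda>G. of_bool (gdeg k G (Suc t) \<noteq> 0)) = E (k * t) (\<lambda>_. 0)"
    using gdeg_le_twice[where v = "Suc t", OF a_pos k_pos _ n] by (intro E_cong) auto
  then show ?case by simp
next
  case (Suc j)
  define n where "n = k * t + j"
  have n: "n \<ge> 1" using assms(1) k_pos by (auto simp: n_def Suc_le_eq)
  have div: "n div k = t" using Suc.prems by (simp add: n_def)
  have size: "gsize k n (Suc t) = j" "gsize k (Suc n) (Suc t) = Suc j"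
    using Suc.prems k_pos by (auto simp: gsize_eq n_def min_def)
  have "E (Suc n) (\<lambda>G. of_bool (gdeg k G (Suc t) \<noteq> Suc j)) \<le>
      E n (\<lambda>G. of_bool (gdeg k G (Suc t) \<noteq> j) + real (Suc j) * a / N n)"
  proof (subst expectation_bo_graph1_Suc[OF a_pos n], rule E_mono)
    fix G assume "G \<in> set_pmf (bo_graph1 a n)"
    then have wf: "wf_mgraph n G"
      using wf_bo_graph1 a_pos n by blast
    let ?x = "gdeg k G (Suc t)" and ?p = "attach_prob a (Suc n) G"
    have "(\<Sum>s\<in>{1..Suc n}. ?p s * of_bool (gdeg k (add_mset {#Suc n, s#} G) (Suc t) \<noteq> Suc j)) \<le>
      (\<Sum>s\<in>{1..Suc n}. of_bool (?x \<noteq> j) * ?p s + of_bool (?x = j) * (?p s * of_bool (grp k s = Suc t)))"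
      using div k_pos by (intro sum_mono)
        (auto simp: of_bool_def grp_Suc intro: attach_prob_nonneg[OF a_pos wf])
    also have "\<dots> = of_bool (?x \<noteq> j) * (\<Sum>s\<in>{1..Suc n}. ?p s)
        + of_bool (?x = j) * (\<Sum>s\<in>{1..Suc n}. ?p s * of_bool (grp k s = Suc t))"
      by (simp only: sum.distrib sum_distrib_left)
    also have "\<dots> = of_bool (?x \<noteq> j) + of_bool (?x = j) * ((real ?x - j + a * real (Suc j)) / N n)"
      by (simp only: sum_attach_prob[OF a_pos wf] sum_attach_prob_grp[OF a_pos wf] size mult_1_right)
    \<comment> \<open>If the degree is still \<open>j\<close>, the excess is zero and only the shift
      \<open>a * Suc j\<close> is left in the attachment probability.\<close>
    also have "\<dots> \<le> of_bool (?x \<noteq> j) + real (Suc j) * a / N n"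
      using N_pos[of n] a_pos by (auto simp: mult.commute)
    finally show "(\<Sum>s\<in>{1..Suc n}. ?p s * of_bool (gdeg k (add_mset {#Suc n, s#} G) (Suc t) \<noteq> Suc j))
      \<le> of_bool (?x \<noteq> j) + real (Suc j) * a / N n" .
  qed
  also have "\<dots> = E n (\<lambda>G. of_bool (gdeg k G (Suc t) \<noteq> j)) + real (Suc j) * a / N n"
    by simp
  also have "real (Suc j) * a / N n \<le> real k * a / N (k * t)"
    using Suc.prems a_pos N_pos[of "k * t"]
    by (intro frac_le mult_right_mono) (auto simp: n_def pdenom_def algebra_simps)
  finally have "E (Suc n) (\<lambda>G. of_bool (gdeg k G (Suc t) \<noteq> Suc j))
      \<le> E n (\<lambda>G. of_bool (gdeg k G (Suc t) \<noteq> j)) + real k * a / N (k * t)"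
    by simp
  moreover have "real (Suc j) * (real k * a / N (k * t))
      = real j * (real k * a / N (k * t)) + real k * a / N (k * t)"
    by (simp only: of_nat_Suc ring_distribs mult_1)
  moreover have "E n (\<lambda>G. of_bool (gdeg k G (Suc t) \<noteq> j)) \<le> real j * (real k * a / N (k * t))"
    unfolding n_def using Suc by simp
  ultimately show ?case
    unfolding add_Suc_right n_def[symmetric] by linarith
qed

end

subsection \<open>The supersolution\<close>

text \<open>\<open>1 - t\<close> is the convex combination of \<open>1\<close> and
  \<open>1 - \<alpha> * t\<close> with weight \<open>1 / \<alpha>\<close> on the latter, so this is
  concavity of \<open>ln\<close>.\<close>

lemma Bernoulli_powr:
  fixes \<alpha> t :: real
  assumes "\<alpha> \<ge> 1" "0 \<le> t" "\<alpha> * t < 1"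
  shows "1 - \<alpha> * t \<le> (1 - t) powr \<alpha>"
proof -
  have "t \<le> \<alpha> * t" using assms by (simp add: mult_le_cancel_right1)
  then have t: "t < 1" using assms by simp
  have conc: "v * ln (1 - \<alpha> * t) \<le> ln (u * 1 + v * (1 - \<alpha> * t))"
    if "u \<ge> 0" "v \<ge> 0" "u + v = 1" for u v
    using ln_concave[unfolded concave_on_iff] assms that
    by (elim conjE) (drule bspec[of _ _ 1], simp, drule bspec[of _ _ "1 - \<alpha> * t"], simp_all)
  have "1 / \<alpha> * ln (1 - \<alpha> * t) \<le> ln ((1 - 1 / \<alpha>) * 1 + 1 / \<alpha> * (1 - \<alpha> * t))"
    using assms(1) by (intro conc) auto
  also have "(1 - 1 / \<alpha>) * 1 + 1 / \<alpha> * (1 - \<alpha> * t) = 1 - t"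
    using assms(1) by (simp add: field_simps)
  finally have "ln (1 - \<alpha> * t) \<le> \<alpha> * ln (1 - t)"
    using assms(1) by (simp add: field_simps)
  then have "exp (ln (1 - \<alpha> * t)) \<le> exp (\<alpha> * ln (1 - t))"
    by (simp only: exp_le_cancel_iff)
  then show ?thesis
    using assms t by (simp add: powr_def)
qed

context buckley_osthus
begin

text \<open>From \<open>2 * k\<close> on, this is a constant multiple of
  \<open>Gamma (w d) / Gamma (w d + a + 2)\<close>. It is kept constant up to \<open>2 * k\<close>
  because a node may have any such degree from \<open>k\<close> on when it becomes complete.\<close>

primrec h :: "nat \<Rightarrow> real" where
  "h 0 = 1"
| "h (Suc d) = (if Suc d \<le> 2 * k then 1 else h d * (w d / (w d + a + 2)))"

lemma w_Suc: "d \<ge> k \<Longrightarrow> w (Suc d) = w d + 1"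
  by (simp add: w_def)

lemma w_mono: "d \<le> d' \<Longrightarrow> w d \<le> w d'"
  using a_pos by (auto simp: w_def)

lemma w_pos: "d \<ge> k \<Longrightarrow> w d > 0"
  using a_pos k_pos by (auto simp: w_def intro!: add_nonneg_pos)

lemma w_ge: "d \<ge> k \<Longrightarrow> w d \<ge> min 1 a * real d"
proof -
  assume "d \<ge> k"
  have "min 1 a * (real d - real k) + min 1 a * real k \<le> 1 * (real d - real k) + a * real k"
    using \<open>d \<ge> k\<close> a_pos by (intro add_mono mult_right_mono) auto
  then show ?thesis using \<open>d \<ge> k\<close> by (simp add: w_def algebra_simps)
qed

lemma h_eq_1: "d \<le> 2 * k \<Longrightarrow> h d = 1"
  by (cases d) auto

lemma h_pos: "h d > 0"
proof (induction d)
  case (Suc d)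
  show ?case
  proof (cases "Suc d \<le> 2 * k")
    case False
    then have "w d > 0" using k_pos by (intro w_pos) auto
    then show ?thesis using Suc a_pos False by (auto intro!: divide_pos_pos)
  qed auto
qed auto

lemma h_antimono: "antimono h"
proof (rule decseq_SucI)
  fix d
  have "h d * (w d / (w d + a + 2)) \<le> h d * 1"
    using w_nonneg[of d] a_pos h_pos[of d] by (intro mult_left_mono) auto
  then show "h (Suc d) \<le> h d" using h_eq_1[of d] by auto
qed

lemma h_le_1: "h d \<le> 1"
  using antimonoD[OF h_antimono, of 0 d] by simp

text \<open>\<open>h\<close> turns \<open>n * h d\<close> into a supersolution of the recursion for the mean
  number of nodes of degree \<open>d\<close>; the slack for \<open>d \<le> 2 * k\<close> absorbs the newly
  created nodes.\<close>

lemma h_supersolution: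
  assumes "d \<ge> k"
  shows "w (d - 1) * h (d - 1) + of_bool (d \<le> 2 * k) \<le> (w d + 1 + a) * h d"
proof (cases "d \<le> 2 * k")
  case True
  then show ?thesis using w_mono[of "d - 1" d] a_pos by (simp add: h_eq_1)
next
  case False
  then obtain e where e: "d = Suc e" "e \<ge> k" by (cases d) auto
  have "w e + a + 2 > 0" using w_nonneg[of e] a_pos by simp
  then show ?thesis using False by (simp add: e w_Suc field_simps)
qed

lemma h_supersolution':
  assumes "d \<ge> k"
  shows "w (d - 1) * h (d - 1) \<le> (w d + 1 + a) * h d"
  by (rule order_trans[OF _ h_supersolution[OF assms]]) simp

text \<open>The drop is 1 for \<open>d > k\<close>, while for \<open>d = k\<close> it is
  \<open>w k = k * a\<close> because \<open>w (k - 1) = 0\<close>. In the covariance recursion this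
  gap is the margin that pays for the source terms.\<close>

lemma w_pred_le:
  assumes "d \<ge> k"
  shows "w (d - 1) \<le> w d - min 1 (real k * a)"
proof (cases "d = k")
  case True
  then show ?thesis using k_pos by (simp add: w_def)
next
  case False
  then obtain e where "d = Suc e" "e \<ge> k" using assms by (cases d) auto
  then show ?thesis by (simp add: w_Suc)
qed

text \<open>The value of \<open>h d * (w d + 1 + a) powr (2 + a)\<close> at
  \<open>d = 2 * k\<close>, times the cost of replacing \<open>w d\<close> by its lower bound
  \<open>min 1 a * d\<close>.\<close>

definition hC :: real where
  "hC = (w (2 * k) + 1 + a) powr (2 + a) * min 1 a powr (- 2 - a)"

lemma h_le:
  assumes "d \<ge> k"
  shows "h d \<le> hC * real d powr (- 2 - a)"
proof -
  let ?x = "\<lambda>d. w d + 1 + a"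
  have x: "?x d > 0" for d using w_nonneg[of d] a_pos by simp
  \<comment> \<open>From \<open>2 * k\<close> on the left side does not increase with
    \<open>d\<close>; up to \<open>2 * k\<close>, \<open>h\<close> is 1 and the power is
    monotone.\<close>
  have *: "h d * ?x d powr (2 + a) \<le> ?x (2 * k) powr (2 + a)"
  proof (cases "d \<le> 2 * k")
    case True
    then show ?thesis using w_mono[OF True] x[of d] a_pos by (simp add: h_eq_1 powr_mono2)
  next
    case False
    then have "2 * k \<le> d" by simp
    then show ?thesis
    proof (induction d rule: nat_induct_at_least)
      case base
      then show ?case by (simp add: h_eq_1)
    next
      case (Suc d)
      then have xS: "?x (Suc d) = w d + a + 2" by (simp add: w_Suc)
      have pos: "w d + a + 2 > 0" using w_nonneg[of d] a_pos by simp
      have "w d > 0" using Suc.hyps by (intro w_pos) auto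
      \<comment> \<open>With \<open>t = 1 / (w d + a + 2)\<close> the left side of Bernoulli's
        inequality is the ratio \<open>h (Suc d) / h d\<close>, and the base on the right is
        \<open>?x d / ?x (Suc d)\<close>.\<close>
      then have "1 - (2 + a) * (1 / (w d + a + 2)) \<le> (1 - 1 / (w d + a + 2)) powr (2 + a)"
        using a_pos pos by (intro Bernoulli_powr) auto
      also have "1 - (2 + a) * (1 / (w d + a + 2)) = w d / (w d + a + 2)"
        using pos by (simp add: field_simps)
      also have "1 - 1 / (w d + a + 2) = ?x d / (w d + a + 2)"
        using pos by (simp add: field_simps)
      finally have "w d / (w d + a + 2) * (w d + a + 2) powr (2 + a) \<le> ?x d powr (2 + a)"
        using x[of d] pos by (simp add: powr_divide field_simps)
      then have "h d * (w d / (w d + a + 2) * (w d + a + 2) powr (2 + a)) \<le> h d * ?x d powr (2 + a)"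
        using h_pos[of d] by (intro mult_left_mono) auto
      with Suc show ?case by (simp add: xS mult.assoc)
    qed
  qed
  have d: "real d > 0" using assms k_pos by simp
  have m: "min 1 a > 0" using a_pos by simp
  have "h d * (min 1 a * real d) powr (2 + a) \<le> h d * ?x d powr (2 + a)"
    using w_ge[OF assms] m d a_pos h_pos[of d] by (intro mult_left_mono powr_mono2) auto
  with * have "h d * (min 1 a powr (2 + a) * real d powr (2 + a)) \<le> ?x (2 * k) powr (2 + a)"
    using m d by (simp add: powr_mult)
  moreover have "(- 2 - a) = - (2 + a)" by simp
  moreover have "min 1 a powr (2 + a) > 0" "real d powr (2 + a) > 0" using m d by auto
  ultimately show ?thesis
    unfolding hC_def by (simp only: powr_minus) (simp add: field_simps)
qed

lemma hC_pos: "hC > 0"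
  using a_pos w_nonneg[of "2 * k"] by (simp add: hC_def)

lemma h_mult_square_le:
  assumes "d \<ge> k"
  shows "real d * real d * h d \<le> hC"
proof -
  have d: "real d \<ge> 1" using assms k_pos by simp
  have "real d * real d * h d \<le> real d powr 2 * (hC * real d powr (- 2 - a))"
    using h_le[OF assms] d by (simp add: power2_eq_square mult_left_mono)
  also have "\<dots> = hC * (real d powr 2 * real d powr (- 2 - a))"
    by (simp only: mult_ac)
  also have "real d powr 2 * real d powr (- 2 - a) = real d powr (- a)"
    by (subst powr_add[symmetric]) simp
  also have "real d powr (- a) \<le> real d powr 0"
    using d a_pos by (intro powr_mono) auto
  finally show ?thesis using d hC_pos by (simp add: mult_left_le)
qed

lemma h_mult_le:
  assumes "d \<ge> k"
  shows "real d * h d \<le> hC"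
proof -
  have "1 * (real d * h d) \<le> real d * (real d * h d)"
    using assms k_pos h_pos[of d] by (intro mult_right_mono) auto
  then show ?thesis using h_mult_square_le[OF assms] by simp
qed

text \<open>Raising the smaller degree to the larger one, \<open>y\<close>, produces
  \<open>y * y * h y\<close>, which is bounded because the decay exponent exceeds 2. The value of
  \<open>h\<close> at the smaller degree is left over.\<close>

lemma h_mult_mult_le:
  assumes "d1 \<ge> k" "d2 \<ge> k"
  shows "(real d1 * h d1) * (real d2 * h d2) \<le> hC * (h d1 + h d2)"
proof -
  have *: "(real x * h x) * (real y * h y) \<le> hC * h x" if "x \<le> y" "y \<ge> k" for x y
  proof -
    have "(real x * h x) * (real y * h y) \<le> (real y * h x) * (real y * h y)"
      using that h_pos[of x] h_pos[of y] by (intro mult_right_mono) auto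
    also have "\<dots> = (real y * real y * h y) * h x" by simp
    also have "\<dots> \<le> hC * h x"
      using h_mult_square_le[OF that(2)] h_pos[of x] by (intro mult_right_mono) auto
    finally show ?thesis .
  qed
  show ?thesis
  proof (cases "d1 \<le> d2")
    case True
    then show ?thesis using *[OF True assms(2)] mult_pos_pos[OF hC_pos h_pos[of d2]] by (simp add: ring_distribs)
  next
    case False
    then show ?thesis using *[of d2 d1] assms mult_pos_pos[OF hC_pos h_pos[of d1]] by (simp add: ring_distribs mult.commute)
  qed
qed

end

subsection \<open>Bounds on means and covariances\<close>

context buckley_osthus
begin

text \<open>From \<open>n0\<close> on, \<open>w d1 + w d2 \<le> N n\<close> holds whenever \<open>d1 + d2 \<le> n + 1 + 2 * k\<close>, i.e.
  for all degree pairs reachable at time \<open>n + 1\<close>.\<close>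

definition n0 :: nat where
  "n0 = nat \<lceil>2 * real k + 1 / a\<rceil>"

lemma n0_ge_1: "n0 \<ge> 1"
proof -
  have "2 * real k + 1 / a > 0" using k_pos a_pos by (intro add_pos_pos) auto
  then show ?thesis by (simp add: n0_def Suc_le_eq)
qed

lemma n0_le_imp:
  assumes "n \<ge> n0"
  shows "a * real n \<ge> 2 * real k * a + 1"
proof -
  have "real n \<ge> 2 * real k + 1 / a" 
    using assms real_nat_ceiling_ge[of "2 * real k + 1 / a"] unfolding n0_def
    by (meson of_nat_mono order_trans)
  then have "a * real n \<ge> a * (2 * real k + 1 / a)" using a_pos by (intro mult_left_mono) auto
  then show ?thesis using a_pos by (simp add: algebra_simps)
qed

lemma N_Suc: "N (Suc n) = N n + (1 + a)"
  by (simp add: pdenom_def algebra_simps)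

lemma N_ge: "N n \<ge> real n"
  using a_pos by (simp add: pdenom_def algebra_simps)

lemma h_le_small: "d \<le> n0 + k \<Longrightarrow> h (n0 + k) \<le> h d"
  using antimonoD[OF h_antimono] by simp

section \<open>Mean degree counts and total drift\<close>

definition mean_deg :: "nat \<Rightarrow> nat \<Rightarrow> real" where
  "mean_deg n d = (\<Sum>u\<in>{1..n div k}. deg_prob n u d)"

lemma mean_deg_nonneg: "mean_deg n d \<ge> 0"
  by (simp add: mean_deg_def sum_nonneg deg_prob_nonneg)

lemma complete_groups_Suc:
  obtains "Suc n div k = n div k"
  | "Suc n div k = Suc (n div k)" "Suc n = k * Suc (n div k)"
proof (cases "Suc n mod k = 0")
  case True
  then have "Suc n div k = Suc (n div k)" by (simp add: div_Suc)
  with True that(2) show ?thesis by (metis mult_div_mod_eq add_0_right)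
next
  case False
  then show ?thesis using that(1) by (simp add: div_Suc)
qed

lemma div_k_le: "n div k \<le> n"
  by (rule div_le_dividend)

text \<open>A node that has just been completed was touched only by the edges of its own
  \<open>k\<close> steps, so its degree is at most \<open>2 * k\<close>.\<close>

lemma deg_prob_new_le:
  assumes "Suc n = k * Suc (n div k)"
  shows "deg_prob (Suc n) (Suc (n div k)) d \<le> of_bool (d \<le> 2 * k)"
proof (cases "d \<le> 2 * k")
  case False
  have "deg_prob (Suc n) (Suc (n div k)) d = 0"
  proof (rule deg_prob_eq_0)
    fix G assume "G \<in> set_pmf (bo_graph1 a (Suc n))"
    then have "gdeg k G (Suc (n div k)) \<le> 2 * (Suc n - k * (Suc (n div k) - 1))"
      by (intro gdeg_le_twice[OF a_pos k_pos]) auto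
    also have "\<dots> = 2 * k" by (subst assms) (simp add: algebra_simps)
    finally show "gdeg k G (Suc (n div k)) \<noteq> d" using False by simp
  qed
  then show ?thesis using False by simp
qed (simp add: deg_prob_le_1)

lemma sum_drift:
  "(\<Sum>u\<in>{1..n div k}. drift n u d) = (w (d - 1) * mean_deg n (d - 1) - w d * mean_deg n d) / N n"
  unfolding drift_def mean_deg_def
  by (simp only: sum_divide_distrib[symmetric] sum_subtractf sum_distrib_left[symmetric])

lemma mean_deg_Suc_le:
  assumes "n \<ge> 1"
  shows "mean_deg (Suc n) d \<le> mean_deg n d
    + (w (d - 1) * mean_deg n (d - 1) - w d * mean_deg n d) / N n + of_bool (d \<le> 2 * k)"
proof -
  have old: "(\<Sum>u\<in>{1..n div k}. deg_prob (Suc n) u d) =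
      mean_deg n d + (w (d - 1) * mean_deg n (d - 1) - w d * mean_deg n d) / N n"
    unfolding sum_drift[symmetric] unfolding mean_deg_def
    using assms by (simp add: deg_prob_Suc sum.distrib)
  show ?thesis
  proof (cases rule: complete_groups_Suc[of n])
    case 1
    then show ?thesis using old by (simp add: mean_deg_def)
  next
    case 2
    then show ?thesis using old deg_prob_new_le[OF 2(2), of d] by (simp add: mean_deg_def)
  qed
qed

lemma mean_deg_le_small:
  assumes "n \<ge> 1" "n \<le> n0"
  shows "mean_deg n d \<le> N n * h d / h (n0 + k)"
proof (cases "d \<le> n0 + k")
  case True
  have "mean_deg n d \<le> real (n div k)"
    using sum_bounded_above[of "{1..n div k}" "\<lambda>u. deg_prob n u d" 1]
    by (simp add: mean_deg_def deg_prob_le_1)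
  also have "\<dots> \<le> real n" by (simp add: div_k_le)
  also have "\<dots> \<le> N n * 1" using N_ge by simp
  also have "N n * 1 \<le> N n * (h d / h (n0 + k))"
    using h_le_small[OF True] h_pos[of "n0 + k"] N_pos[of n] by (intro mult_left_mono) auto
  finally show ?thesis by simp
next
  case False
  then have "mean_deg n d = 0"
    using assms by (simp add: mean_deg_def deg_prob_eq_0_large)
  then show ?thesis using N_pos[of n] h_pos by (simp add: less_imp_le)
qed

text \<open>Up to time \<open>n0\<close> complete nodes have degree at most \<open>n0 + k\<close>,
  and \<open>h\<close> is antitone, so \<open>meanC * h d \<ge> 1\<close> for every degree that
  occurs by then.\<close>

definition meanC :: real where
  "meanC = 1 / h (n0 + k)"

lemma meanC_ge_1: "meanC \<ge> 1"
  using h_pos h_le_1 by (simp add: meanC_def)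

lemma mean_deg_le:
  assumes "n \<ge> 1" "d \<ge> k"
  shows "mean_deg n d \<le> meanC * N n * h d"
proof (cases "n \<le> n0")
  case True
  then show ?thesis using mean_deg_le_small[OF assms(1) True, of d] by (simp add: meanC_def)
next
  case False
  then have "n0 \<le> n" by simp
  then show ?thesis using assms(2)
  proof (induction n arbitrary: d rule: nat_induct_at_least)
    case base
    then show ?case using mean_deg_le_small[OF n0_ge_1 order_refl, of d] by (simp add: meanC_def)
  next
    case (Suc n)
    have n: "n \<ge> 1" using Suc.hyps n0_ge_1 by simp
    show ?case
    proof (cases "d \<le> Suc n + k")
      case False
      have "mean_deg (Suc n) d = 0"
        unfolding mean_deg_def using False by (intro sum.neutral ballI deg_prob_eq_0_large) auto
      then show ?thesis using meanC_ge_1 N_pos[of "Suc n"] h_pos[of d] by simp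
    next
      case True
      \<comment> \<open>For degrees reachable at time \<open>Suc n\<close> the coefficient
        \<open>1 - w d / N n\<close> is nonnegative, so upper bounds may be inserted into the
        recursion.\<close>
      have "w d \<le> real n + 1 + real k * a" using True Suc.prems by (simp add: w_def)
      also have "\<dots> \<le> N n"
      proof -
        have "real k * a \<ge> 0" using a_pos by simp
        then show ?thesis
          using n0_le_imp[OF Suc.hyps] a_pos unfolding pdenom_def ring_distribs by linarith
      qed
      finally have wN: "1 - w d / N n \<ge> 0" using N_pos[of n] by simp
      \<comment> \<open>For \<open>d = k\<close> the induction hypothesis says nothing about
        \<open>d - 1\<close>, but then \<open>w (d - 1) = 0\<close>.\<close>
      have pred: "w (d - 1) * mean_deg n (d - 1) \<le> w (d - 1) * (meanC * N n * h (d - 1))"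
      proof (cases "d - 1 < k")
        case False
        then show ?thesis using Suc.IH[of "d - 1"] w_nonneg[of "d - 1"] by (intro mult_left_mono) auto
      qed (simp add: w_def)
      have "mean_deg (Suc n) d \<le>
          (1 - w d / N n) * mean_deg n d + w (d - 1) * mean_deg n (d - 1) / N n + of_bool (d \<le> 2 * k)"
        using mean_deg_Suc_le[OF n, of d] by (simp add: algebra_simps diff_divide_distrib)
      also have "\<dots> \<le> (1 - w d / N n) * (meanC * N n * h d)
          + w (d - 1) * (meanC * N n * h (d - 1)) / N n + meanC * of_bool (d \<le> 2 * k)"
        using wN Suc.IH[OF Suc.prems] N_pos[of n] meanC_ge_1
        by (intro add_mono mult_left_mono divide_right_mono pred) auto
      also have "\<dots> = meanC * (N n * h d - w d * h d + (w (d - 1) * h (d - 1) + of_bool (d \<le> 2 * k)))"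
        using N_pos[of n] by (simp add: field_simps)
      \<comment> \<open>The surplus \<open>(1 + a) * h d\<close> is exactly the growth from
        \<open>N n\<close> to \<open>N (Suc n)\<close>.\<close>
      also have "\<dots> \<le> meanC * (N n * h d - w d * h d + (w d + 1 + a) * h d)"
        using h_supersolution[OF Suc.prems] meanC_ge_1 by (intro mult_left_mono add_mono) auto
      also have "\<dots> = meanC * N (Suc n) * h d"
        by (simp add: N_Suc algebra_simps)
      finally show ?thesis .
    qed
  qed
qed

definition driftC :: real where
  "driftC = meanC * (3 + a + 2 * real k * a)"

text \<open>After the triangle inequality the bound on the means, linear in \<open>N n\<close>,
  cancels the denominator of the drift. The result is uniform in \<open>n\<close> and costs only a
  factor \<open>d\<close>.\<close>

lemma sum_abs_drift_le:
  assumes "n \<ge> 1" "d \<ge> k"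
  shows "(\<Sum>u\<in>{1..n div k}. \<bar>drift n u d\<bar>) \<le> driftC * (real d * h d)"
proof -
  have pred: "w (d - 1) * mean_deg n (d - 1) \<le> w (d - 1) * (meanC * N n * h (d - 1))"
  proof (cases "d - 1 < k")
    case False
    then show ?thesis using mean_deg_le[OF assms(1), of "d - 1"] w_nonneg[of "d - 1"]
      by (intro mult_left_mono) auto
  qed (simp add: w_def)
  have "(\<Sum>u\<in>{1..n div k}. \<bar>drift n u d\<bar>) \<le>
      (\<Sum>u\<in>{1..n div k}. (w (d - 1) * deg_prob n u (d - 1) + w d * deg_prob n u d) / N n)"
  proof (rule sum_mono)
    fix u
    have "0 \<le> w (d - 1) * deg_prob n u (d - 1)" "0 \<le> w d * deg_prob n u d"
      by (simp_all add: w_nonneg deg_prob_nonneg)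
    then show "\<bar>drift n u d\<bar> \<le> (w (d - 1) * deg_prob n u (d - 1) + w d * deg_prob n u d) / N n"
      using N_pos[of n] by (simp add: drift_def divide_right_mono abs_le_iff)
  qed
  also have "\<dots> = (w (d - 1) * mean_deg n (d - 1) + w d * mean_deg n d) / N n"
    unfolding mean_deg_def
    by (simp only: sum_divide_distrib[symmetric] sum.distrib sum_distrib_left[symmetric])
  also have "\<dots> \<le> (w (d - 1) * (meanC * N n * h (d - 1)) + w d * (meanC * N n * h d)) / N n"
    using mean_deg_le[OF assms] w_nonneg[of d] N_pos[of n]
    by (intro divide_right_mono add_mono pred mult_left_mono) auto
  also have "\<dots> = meanC * (w (d - 1) * h (d - 1) + w d * h d)"
    using N_pos[of n] by (simp add: field_simps)
  also have "\<dots> \<le> meanC * ((w d + 1 + a) * h d + w d * h d)"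
    using meanC_ge_1 by (intro mult_left_mono add_mono h_supersolution'[OF assms(2)]) (auto simp: w_nonneg)
  also have "\<dots> = meanC * ((2 * w d + 1 + a) * h d)"
    by (simp add: algebra_simps)
  also have "\<dots> \<le> meanC * (((3 + a + 2 * real k * a) * real d) * h d)"
  proof (intro mult_left_mono mult_right_mono)
    have "(1 + a + 2 * real k * a) * 1 \<le> (1 + a + 2 * real k * a) * real d"
      using assms(2) k_pos a_pos by (intro mult_left_mono) auto
    moreover have "2 * w d + 1 + a \<le> 2 * real d + (1 + a + 2 * real k * a)"
      using assms(2) by (simp add: w_def algebra_simps)
    ultimately show "2 * w d + 1 + a \<le> (3 + a + 2 * real k * a) * real d"
      by (simp add: algebra_simps)
  qed (use meanC_ge_1 h_pos[of d] in auto)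
  finally show ?thesis by (simp add: driftC_def mult_ac)
qed

lemma driftC_nonneg: "driftC \<ge> 0"
  using meanC_ge_1 a_pos by (simp add: driftC_def)

section \<open>Sum of absolute covariances over distinct nodes\<close>

definition pair_cov :: "nat \<Rightarrow> nat \<Rightarrow> nat \<Rightarrow> nat \<Rightarrow> nat \<Rightarrow> real" where
  "pair_cov n u v d1 d2 = of_bool (u \<noteq> v) * \<bar>deg_cov n u v d1 d2\<bar>"

lemma pair_cov_same [simp]: "pair_cov n u u d1 d2 = 0"
  by (simp add: pair_cov_def)

lemma pair_cov_le: "pair_cov n u v d1 d2 \<le> \<bar>deg_cov n u v d1 d2\<bar>"
  by (simp add: pair_cov_def)

lemma pair_cov_commute: "pair_cov n u v d1 d2 = pair_cov n v u d2 d1"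
  by (auto simp: pair_cov_def deg_cov_commute[of n u v])

text \<open>The diagonal contributes 0 because \<open>deg_cov_Suc\<close> holds for distinct nodes;
  the true diagonal is bounded by the mean count at the end.\<close>

definition total_cov :: "nat \<Rightarrow> nat \<Rightarrow> nat \<Rightarrow> real" where
  "total_cov n d1 d2 = (\<Sum>u\<in>{1..n div k}. \<Sum>v\<in>{1..n div k}. pair_cov n u v d1 d2)"

lemma deg_cov_eq_0:
  assumes "deg_prob n u d1 = 0 \<or> deg_prob n v d2 = 0"
  shows "deg_cov n u v d1 d2 = 0"
  using assms abs_deg_cov_le[of n u v d1 d2] abs_deg_cov_le[of n v u d2 d1]
  by (auto simp: deg_cov_commute[of n v u])

text \<open>There are at most \<open>n0 * N n\<close> pairs, each contributing at most 2, and
  \<open>meanC * h d1 \<ge> 1\<close> if \<open>d1 \<le> n0 + k\<close>; for larger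
  \<open>d1\<close> all terms vanish.\<close>

lemma total_cov_le_small:
  assumes "n \<ge> 1" "n \<le> n0"
  shows "total_cov n d1 d2 \<le> (2 * real n0 * meanC) * N n * (h d1 + h d2)"
proof (cases "d1 \<le> n0 + k")
  case True
  have "total_cov n d1 d2 \<le> (\<Sum>u\<in>{1..n div k}. \<Sum>v\<in>{1..n div k}. 2)"
    unfolding total_cov_def pair_cov_def
    by (intro sum_mono) (use abs_deg_cov_le_2 in \<open>auto simp: of_bool_def\<close>)
  also have "\<dots> = 2 * (real (n div k) * real (n div k))" by simp
  also have "\<dots> \<le> 2 * (real n0 * N n)"
  proof (intro mult_left_mono mult_mono)
    show "real (n div k) \<le> real n0" using div_k_le[of n] assms by linarith
    have "real (n div k) \<le> real n" by (simp add: div_k_le)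
    then show "real (n div k) \<le> N n" using N_ge[of n] by linarith
  qed auto
  also have "\<dots> = 2 * (real n0 * N n) * 1" by simp
  also have "\<dots> \<le> 2 * (real n0 * N n) * (meanC * (h d1 + h d2))"
  proof (intro mult_left_mono)
    have "1 \<le> meanC * h d1"
      using h_le_small[OF True] h_pos[of "n0 + k"] by (simp add: meanC_def)
    also have "\<dots> \<le> meanC * (h d1 + h d2)"
      using meanC_ge_1 h_pos[of d2] by (intro mult_left_mono) auto
    finally show "1 \<le> meanC * (h d1 + h d2)" .
  qed (use N_pos[of n] in auto)
  finally show ?thesis by (simp add: mult_ac)
next
  case False
  then have "deg_prob n u d1 = 0" if "u \<in> {1..n div k}" for u
    using assms that by (intro deg_prob_eq_0_large) auto
  then have "total_cov n d1 d2 = 0"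
    by (simp add: total_cov_def pair_cov_def deg_cov_eq_0)
  then show ?thesis
    using N_pos[of n] h_pos[of d1] h_pos[of d2] meanC_ge_1 by simp
qed

text \<open>The new node has degree \<open>k\<close> except with probability
  \<open>O(1 / t)\<close>, so \<open>b * (1 - b)\<close> is \<open>O(1 / t)\<close> for the
  probability \<open>b\<close> of degree \<open>d2\<close>. Summing over the \<open>t\<close> old
  nodes gives a bounded total.\<close>

lemma sum_new_cov_le:
  assumes "Suc n = k * Suc (n div k)"
  shows "(\<Sum>u\<in>{1..n div k}. \<bar>deg_cov (Suc n) u (Suc (n div k)) d1 d2\<bar>) \<le> 2 * real k * h d2"
proof (cases "d2 \<le> 2 * k \<and> n div k \<ge> 1")
  case False
  \<comment> \<open>Either \<open>d2 > 2 * k\<close>, which is impossible for a node just completed,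
    or there are no old nodes.\<close>
  then have "deg_cov (Suc n) u (Suc (n div k)) d1 d2 = 0" if "u \<in> {1..n div k}" for u
    using that deg_prob_new_le[OF assms, of d2] deg_prob_nonneg[of "Suc n" "Suc (n div k)" d2]
    by (intro deg_cov_eq_0) auto
  then show ?thesis using h_pos[of d2] by simp
next
  case True
  define t where "t = n div k"
  define b where "b = deg_prob (Suc n) (Suc t) d2"
  define q where "q = E (Suc n) (\<lambda>G. of_bool (gdeg k G (Suc t) \<noteq> k))"
  have t: "t \<ge> 1" "Suc n = k * t + k" using True assms by (simp_all add: t_def algebra_simps)
  have "q \<le> real k * (real k * a / N (k * t))"
    unfolding q_def t(2) by (rule deg_prob_new[OF t(1) order_refl])
  also have "\<dots> \<le> real k * (real k * a / (a * (real k * real t)))"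
    using a_pos k_pos t(1) by (intro mult_left_mono frac_le) (auto simp: pdenom_def algebra_simps)
  also have "\<dots> = real k / real t" using a_pos k_pos by simp
  finally have q: "q \<le> real k / real t" .
  have b: "0 \<le> b" "b \<le> 1" unfolding b_def by (rule deg_prob_nonneg, rule deg_prob_le_1)
  \<comment> \<open>The exceptional probability \<open>q\<close> bounds one of the factors:
    \<open>q = 1 - b\<close> if \<open>d2 = k\<close>, and \<open>b \<le> q\<close>
    otherwise.\<close>
  have "b * (1 - b) \<le> q"
  proof (cases "d2 = k")
    case True
    have "q = E (Suc n) (\<lambda>G. 1 - of_bool (gdeg k G (Suc t) = k))"
      unfolding q_def by (intro E_cong) auto
    then have "q = 1 - b" by (simp add: b_def deg_prob_def True)
    then show ?thesis using b by (simp add: mult_left_le_one_le)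
  next
    case False
    have "b \<le> q" unfolding b_def deg_prob_def q_def using False by (intro E_mono) auto
    moreover have "b * (1 - b) \<le> b" using b by (simp add: mult_left_le)
    ultimately show ?thesis by simp
  qed
  then have "\<bar>deg_cov (Suc n) u (Suc t) d1 d2\<bar> \<le> 2 * (real k / real t)" for u
    using abs_deg_cov_le[of "Suc n" u "Suc t" d1 d2] q unfolding b_def by simp
  then have "(\<Sum>u\<in>{1..t}. \<bar>deg_cov (Suc n) u (Suc t) d1 d2\<bar>) \<le> real (card {1..t}) * (2 * (real k / real t))"
    by (intro sum_bounded_above)
  also have "\<dots> = 2 * real k" using t(1) by simp
  finally show ?thesis using True by (simp add: t_def h_eq_1)
qed

lemma total_cov_Suc_le:
  "total_cov (Suc n) d1 d2 \<le>
    (\<Sum>u\<in>{1..n div k}. \<Sum>v\<in>{1..n div k}. pair_cov (Suc n) u v d1 d2) + 2 * real k * (h d1 + h d2)"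
proof (cases rule: complete_groups_Suc[of n])
  case 1
  then show ?thesis using h_pos[of d1] h_pos[of d2] by (simp add: total_cov_def)
next
  case 2
  let ?t = "n div k"
  have "total_cov (Suc n) d1 d2 =
      (\<Sum>u\<in>{1..?t}. \<Sum>v\<in>{1..?t}. pair_cov (Suc n) u v d1 d2)
      + (\<Sum>u\<in>{1..?t}. pair_cov (Suc n) u (Suc ?t) d1 d2)
      + (\<Sum>v\<in>{1..?t}. pair_cov (Suc n) (Suc ?t) v d1 d2)"
    unfolding total_cov_def 2(1) by (simp add: sum.distrib)
  moreover have "(\<Sum>u\<in>{1..?t}. pair_cov (Suc n) u (Suc ?t) d1 d2) \<le> 2 * real k * h d2"
    by (rule order_trans[OF sum_mono[OF pair_cov_le] sum_new_cov_le[OF 2(2)]])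
  moreover have "(\<Sum>v\<in>{1..?t}. pair_cov (Suc n) (Suc ?t) v d1 d2) \<le> 2 * real k * h d1"
    unfolding pair_cov_commute[of "Suc n" "Suc ?t"]
    by (rule order_trans[OF sum_mono[OF pair_cov_le] sum_new_cov_le[OF 2(2)]])
  ultimately show ?thesis by (simp add: ring_distribs)
qed

text \<open>The second hypothesis makes all coefficients in \<open>deg_cov_Suc\<close> nonnegative,
  so they survive the passage to absolute values; the source terms sum to a product.\<close>

lemma sum_old_cov_le:
  assumes "n \<ge> 1" "(w d1 + w d2) / N n \<le> 1"
  shows "(\<Sum>u\<in>{1..n div k}. \<Sum>v\<in>{1..n div k}. pair_cov (Suc n) u v d1 d2) \<le>
    (1 - (w d1 + w d2) / N n) * total_cov n d1 d2
    + w (d1 - 1) / N n * total_cov n (d1 - 1) d2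
    + w (d2 - 1) / N n * total_cov n d1 (d2 - 1)
    + (\<Sum>u\<in>{1..n div k}. \<bar>drift n u d1\<bar>) * (\<Sum>v\<in>{1..n div k}. \<bar>drift n v d2\<bar>)"
proof -
  let ?A = "1 - (w d1 + w d2) / N n" and ?B = "w (d1 - 1) / N n" and ?C = "w (d2 - 1) / N n"
  have nn: "?A \<ge> 0" "?B \<ge> 0" "?C \<ge> 0"
    using assms(2) w_nonneg N_pos[of n] by (simp_all add: less_imp_le)
  have "pair_cov (Suc n) u v d1 d2 \<le> ?A * pair_cov n u v d1 d2
      + ?B * pair_cov n u v (d1 - 1) d2 + ?C * pair_cov n u v d1 (d2 - 1)
      + \<bar>drift n u d1\<bar> * \<bar>drift n v d2\<bar>"
    if "u \<in> {1..n div k}" "v \<in> {1..n div k}" for u v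
  proof (cases "u = v")
    case False
    let ?x = "deg_cov n u v d1 d2" and ?y = "deg_cov n u v (d1 - 1) d2" and ?z = "deg_cov n u v d1 (d2 - 1)"
    have "\<bar>deg_cov (Suc n) u v d1 d2\<bar> \<le> \<bar>?A * ?x\<bar> + \<bar>?B * ?y\<bar> + \<bar>?C * ?z\<bar> + \<bar>drift n u d1 * drift n v d2\<bar>"
      unfolding deg_cov_Suc[OF assms(1) that False] by linarith
    also have "\<dots> = ?A * \<bar>?x\<bar> + ?B * \<bar>?y\<bar> + ?C * \<bar>?z\<bar> + \<bar>drift n u d1\<bar> * \<bar>drift n v d2\<bar>"
      using nn by (simp only: abs_mult abs_of_nonneg)
    finally show ?thesis using False by (simp add: pair_cov_def)
  qed (simp add: pair_cov_def)
  then have "(\<Sum>u\<in>{1..n div k}. \<Sum>v\<in>{1..n div k}. pair_cov (Suc n) u v d1 d2) \<le>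
      (\<Sum>u\<in>{1..n div k}. \<Sum>v\<in>{1..n div k}. ?A * pair_cov n u v d1 d2
      + ?B * pair_cov n u v (d1 - 1) d2 + ?C * pair_cov n u v d1 (d2 - 1)
      + \<bar>drift n u d1\<bar> * \<bar>drift n v d2\<bar>)"
    by (intro sum_mono)
  also have "\<dots> = ?A * total_cov n d1 d2 + ?B * total_cov n (d1 - 1) d2 + ?C * total_cov n d1 (d2 - 1)
    + (\<Sum>u\<in>{1..n div k}. \<bar>drift n u d1\<bar>) * (\<Sum>v\<in>{1..n div k}. \<bar>drift n v d2\<bar>)"
    unfolding total_cov_def sum_product by (simp only: sum.distrib sum_distrib_left)
  finally show ?thesis .
qed

text \<open>The joint probabilities of distinct nodes vanish here, so each covariance is minus the
  product of the marginals, and the total is at most the product of the two means.\<close>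

lemma total_cov_le_unreachable:
  assumes "n \<ge> 1" "d1 \<ge> k" "d2 \<ge> k" "d1 + d2 > n + 2 * k"
  shows "total_cov n d1 d2 \<le> (meanC * meanC * (2 * a + 1) * hC) * N n * (h d1 + h d2)"
proof -
  have "total_cov n d1 d2 \<le> (\<Sum>u\<in>{1..n div k}. \<Sum>v\<in>{1..n div k}. deg_prob n u d1 * deg_prob n v d2)"
    unfolding total_cov_def
  proof (intro sum_mono)
    fix u v assume "u \<in> {1..n div k}" "v \<in> {1..n div k}"
    then show "pair_cov n u v d1 d2 \<le> deg_prob n u d1 * deg_prob n v d2"
      using deg_prob2_eq_0_large[OF assms(1) _ _ _ assms(4)]
      by (auto simp: pair_cov_def deg_cov_def of_bool_def deg_prob_nonneg)
  qed
  also have "\<dots> = mean_deg n d1 * mean_deg n d2"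
    by (simp only: mean_deg_def sum_product)
  also have "\<dots> \<le> (meanC * N n * h d1) * (meanC * N n * h d2)"
    using assms meanC_ge_1 N_pos[of n] h_pos[of d1]
    by (intro mult_mono mean_deg_le mean_deg_nonneg) auto
  also have "\<dots> = (meanC * meanC * N n * h d1 * h d2) * N n"
    by (simp add: mult_ac)
  \<comment> \<open>One of the two factors \<open>N n\<close> is traded for
    \<open>d1 + d2 > n\<close>; the degrees are then absorbed by
    \<open>d * h d \<le> hC\<close>.\<close>
  also have "\<dots> \<le> (meanC * meanC * N n * h d1 * h d2) * ((2 * a + 1) * (real d1 + real d2))"
  proof (intro mult_left_mono)
    have "a * 1 \<le> a * real n" using assms(1) a_pos by (intro mult_left_mono) auto
    then have "N n \<le> (2 * a + 1) * real n"
      by (simp add: pdenom_def algebra_simps)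
    also have "\<dots> \<le> (2 * a + 1) * (real d1 + real d2)"
      using assms(4) a_pos by (intro mult_left_mono) auto
    finally show "N n \<le> (2 * a + 1) * (real d1 + real d2)" .
  qed (use meanC_ge_1 N_pos[of n] h_pos[of d1] h_pos[of d2] in auto)
  also have "\<dots> = (meanC * meanC * (2 * a + 1) * N n) * (h d2 * (real d1 * h d1) + h d1 * (real d2 * h d2))"
    by (simp add: algebra_simps)
  also have "\<dots> \<le> (meanC * meanC * (2 * a + 1) * N n) * (h d2 * hC + h d1 * hC)"
    using h_mult_le[OF assms(2)] h_mult_le[OF assms(3)] meanC_ge_1 a_pos N_pos[of n] h_pos[of d1] h_pos[of d2]
    by (intro mult_left_mono add_mono) auto
  finally show ?thesis by (simp add: algebra_simps)
qed

text \<open>The first two summands cover early times and unreachable pairs. The third makes the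
  margin \<open>covC * min 1 (k * a)\<close> dominate the drift source and the contribution of new
  nodes.\<close>

definition covC :: real where
  "covC = 2 * real n0 * meanC + meanC * meanC * (2 * a + 1) * hC
    + (driftC * driftC * hC + 2 * real k) / min 1 (real k * a)"

lemma covC_ge:
  "covC \<ge> 2 * real n0 * meanC" "covC \<ge> meanC * meanC * (2 * a + 1) * hC" "covC \<ge> 0"
  "covC * min 1 (real k * a) \<ge> driftC * driftC * hC + 2 * real k"
proof -
  let ?x = "2 * real n0 * meanC" and ?y = "meanC * meanC * (2 * a + 1) * hC"
    and ?z = "driftC * driftC * hC + 2 * real k" and ?m = "min 1 (real k * a)"
  have nn: "?x \<ge> 0" "?y \<ge> 0" "?z \<ge> 0" "?m > 0"
    using meanC_ge_1 a_pos hC_pos k_pos driftC_nonneg by simp_all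
  then show "covC \<ge> ?x" "covC \<ge> ?y" "covC \<ge> 0" by (simp_all add: covC_def)
  have "?z = ?z / ?m * ?m" using nn by simp
  also have "\<dots> \<le> covC * ?m" using nn by (intro mult_right_mono) (simp_all add: covC_def)
  finally show "covC * ?m \<ge> ?z" .
qed

lemma total_cov_le:
  assumes "n \<ge> 1" "d1 \<ge> k" "d2 \<ge> k"
  shows "total_cov n d1 d2 \<le> covC * N n * (h d1 + h d2)"
proof -
  have small: "total_cov n d1 d2 \<le> covC * N n * (h d1 + h d2)" if "n \<ge> 1" "n \<le> n0" for n d1 d2
  proof -
    have "total_cov n d1 d2 \<le> (2 * real n0 * meanC) * N n * (h d1 + h d2)"
      by (rule total_cov_le_small[OF that])
    also have "\<dots> \<le> covC * N n * (h d1 + h d2)"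
      using covC_ge N_pos[of n] h_pos[of d1] h_pos[of d2] by (intro mult_right_mono) auto
    finally show ?thesis .
  qed
  show ?thesis
  proof (cases "n \<le> n0")
    case True
    then show ?thesis using small assms by simp
  next
    case False
    then have "n0 \<le> n" by simp
    then show ?thesis using assms(2,3)
    proof (induction n arbitrary: d1 d2 rule: nat_induct_at_least)
      case base
      then show ?case using small n0_ge_1 by simp
    next
      case (Suc n)
      let ?H = "h d1 + h d2" and ?m = "min 1 (real k * a)"
      have n: "n \<ge> 1" using Suc.hyps n0_ge_1 by simp
      have H: "?H > 0" using h_pos[of d1] h_pos[of d2] by simp
      show ?case
      proof (cases "d1 + d2 \<le> Suc n + 2 * k")
        case False
        then have "total_cov (Suc n) d1 d2 \<le> (meanC * meanC * (2 * a + 1) * hC) * N (Suc n) * ?H"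
          using Suc.prems by (intro total_cov_le_unreachable) auto
        also have "\<dots> \<le> covC * N (Suc n) * ?H"
          using covC_ge N_pos[of "Suc n"] H by (intro mult_right_mono) auto
        finally show ?thesis .
      next
        case True
        \<comment> \<open>Reachability of the pair at time \<open>Suc n\<close>, together with
          \<open>n \<ge> n0\<close>, makes the coefficient of the current covariance
          nonnegative.\<close>
        have "w d1 + w d2 \<le> real n + 1 + 2 * real k * a"
          using True Suc.prems by (simp add: w_def)
        also have "\<dots> \<le> N n"
          using n0_le_imp[OF Suc.hyps] a_pos by (simp add: pdenom_def algebra_simps)
        finally have wN: "(w d1 + w d2) / N n \<le> 1" using N_pos[of n] by simp
        have pred1: "w (d1 - 1) / N n * total_cov n (d1 - 1) d2
            \<le> w (d1 - 1) / N n * (covC * N n * (h (d1 - 1) + h d2))"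
        proof (cases "d1 - 1 < k")
          case False
          then show ?thesis using Suc.IH[of "d1 - 1" d2] Suc.prems w_nonneg[of "d1 - 1"] N_pos[of n]
            by (intro mult_left_mono) auto
        qed (simp add: w_def)
        have pred2: "w (d2 - 1) / N n * total_cov n d1 (d2 - 1)
            \<le> w (d2 - 1) / N n * (covC * N n * (h d1 + h (d2 - 1)))"
        proof (cases "d2 - 1 < k")
          case False
          then show ?thesis using Suc.IH[of d1 "d2 - 1"] Suc.prems w_nonneg[of "d2 - 1"] N_pos[of n]
            by (intro mult_left_mono) auto
        qed (simp add: w_def)
        have "(\<Sum>u\<in>{1..n div k}. \<bar>drift n u d1\<bar>) * (\<Sum>v\<in>{1..n div k}. \<bar>drift n v d2\<bar>)
            \<le> (driftC * (real d1 * h d1)) * (driftC * (real d2 * h d2))"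
          using Suc.prems n driftC_nonneg h_pos[of d1]
          by (intro mult_mono sum_abs_drift_le sum_nonneg) auto
        also have "\<dots> = driftC * driftC * ((real d1 * h d1) * (real d2 * h d2))"
          by (simp only: mult_ac)
        also have "\<dots> \<le> driftC * driftC * (hC * ?H)"
          using h_mult_mult_le[OF Suc.prems] driftC_nonneg by (intro mult_left_mono) auto
        finally have dr: "(\<Sum>u\<in>{1..n div k}. \<bar>drift n u d1\<bar>) * (\<Sum>v\<in>{1..n div k}. \<bar>drift n v d2\<bar>)
            \<le> driftC * driftC * (hC * ?H)" .
        have main: "(1 - (w d1 + w d2) / N n) * total_cov n d1 d2
            \<le> (1 - (w d1 + w d2) / N n) * (covC * N n * ?H)"
          using wN Suc.IH[OF Suc.prems] by (intro mult_left_mono) auto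
        have "total_cov (Suc n) d1 d2 \<le> (1 - (w d1 + w d2) / N n) * (covC * N n * ?H)
            + w (d1 - 1) / N n * (covC * N n * (h (d1 - 1) + h d2))
            + w (d2 - 1) / N n * (covC * N n * (h d1 + h (d2 - 1)))
            + driftC * driftC * (hC * ?H) + 2 * real k * ?H"
          using total_cov_Suc_le[of n d1 d2] sum_old_cov_le[OF n wN] main pred1 pred2 dr by linarith
        also have "\<dots> = covC * (N n * ?H - (w d1 + w d2) * ?H + w (d1 - 1) * h (d1 - 1)
            + w (d1 - 1) * h d2 + w (d2 - 1) * h d1 + w (d2 - 1) * h (d2 - 1))
            + (driftC * driftC * hC + 2 * real k) * ?H"
          using N_pos[of n] by (simp add: field_simps)
        \<comment> \<open>By \<open>w_pred_le\<close> the cross terms leave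
          \<open>- covC * ?m * ?H\<close>, which cancels the bound for the source terms. What
          remains is \<open>covC * (N n + 1 + a) * ?H\<close>.\<close>
        also have "\<dots> \<le> covC * (N n * ?H - (w d1 + w d2) * ?H + (w d1 + 1 + a) * h d1
            + (w d1 - ?m) * h d2 + (w d2 - ?m) * h d1 + (w d2 + 1 + a) * h d2)
            + (covC * ?m) * ?H"
        proof (intro add_mono mult_left_mono mult_right_mono covC_ge)
          show "w (d1 - 1) * h (d1 - 1) \<le> (w d1 + 1 + a) * h d1"
            "w (d2 - 1) * h (d2 - 1) \<le> (w d2 + 1 + a) * h d2"
            by (fact h_supersolution'[OF Suc.prems(1)], fact h_supersolution'[OF Suc.prems(2)])
        qed (use w_pred_le Suc.prems H h_pos less_imp_le in auto)
        also have "\<dots> = covC * N (Suc n) * ?H"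
          by (simp add: N_Suc algebra_simps)
        finally show ?thesis .
      qed
    qed
  qed
qed

section \<open>Covariance of the degree counts\<close>

lemma num_degree_merge_nodes:
  "real (num_degree d t (merge_nodes k G)) = (\<Sum>v\<in>{1..t}. of_bool (gdeg k G v = d))"
  unfolding num_degree_def gdeg_def of_bool_def by (subst sum.inter_filter[symmetric]) simp_all

lemma covariance_num_degree:
  "covariance (measure_pmf (bo_graph a k t)) (\<lambda>G. real (num_degree d1 t G)) (\<lambda>G. real (num_degree d2 t G))
    = (\<Sum>u\<in>{1..t}. \<Sum>v\<in>{1..t}. deg_cov (k * t) u v d1 d2)"
proof -
  define n where "n = k * t"
  define X where "X = (\<lambda>d G. \<Sum>v\<in>{1..t}. of_bool (gdeg k G v = d) :: real)"
  have EX: "E n (X d) = (\<Sum>v\<in>{1..t}. deg_prob n v d)" for d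
    unfolding X_def deg_prob_def by (rule Bochner_Integration.integral_sum) simp
  have "covariance (measure_pmf (bo_graph a k t)) (\<lambda>G. real (num_degree d1 t G)) (\<lambda>G. real (num_degree d2 t G))
      = E n (\<lambda>G. (X d1 G - E n (X d1)) * (X d2 G - E n (X d2)))"
    by (simp add: covariance_def bo_graph_def num_degree_merge_nodes X_def n_def)
  also have "\<dots> = E n (\<lambda>G. X d1 G * X d2 G - E n (X d2) * X d1 G - E n (X d1) * X d2 G
      + E n (X d1) * E n (X d2))"
    by (intro E_cong) (simp add: algebra_simps)
  also have "\<dots> = E n (\<lambda>G. X d1 G * X d2 G) - E n (X d1) * E n (X d2)"
    by simp
  also have "E n (\<lambda>G. X d1 G * X d2 G) = (\<Sum>u\<in>{1..t}. \<Sum>v\<in>{1..t}. deg_prob2 n u v d1 d2)"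
    unfolding X_def sum_product deg_prob2_def
    by (simp only: Bochner_Integration.integral_sum integrable_E)
  also have "E n (X d1) * E n (X d2) = (\<Sum>u\<in>{1..t}. \<Sum>v\<in>{1..t}. deg_prob n u d1 * deg_prob n v d2)"
    by (simp only: EX sum_product)
  finally show ?thesis
    by (simp only: deg_cov_def sum_subtractf n_def)
qed

lemma abs_covariance_num_degree_le:
  assumes "d1 \<ge> k" "d2 \<ge> k" "t \<ge> 1"
  shows "\<bar>covariance (measure_pmf (bo_graph a k t))
      (\<lambda>G. real (num_degree d1 t G)) (\<lambda>G. real (num_degree d2 t G))\<bar>
    \<le> (covC + 2 * meanC) * N (k * t) * (h d1 + h d2)"
proof -
  define n where "n = k * t"
  have n: "n \<ge> 1" "n div k = t" using assms k_pos by (auto simp: n_def Suc_le_eq)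
  have "\<bar>\<Sum>u\<in>{1..t}. \<Sum>v\<in>{1..t}. deg_cov n u v d1 d2\<bar> \<le> (\<Sum>u\<in>{1..t}. \<Sum>v\<in>{1..t}. \<bar>deg_cov n u v d1 d2\<bar>)"
    by (intro order_trans[OF sum_abs] sum_mono sum_abs)
  also have "\<dots> = (\<Sum>u\<in>{1..t}. \<Sum>v\<in>{1..t}. pair_cov n u v d1 d2 + (if u = v then \<bar>deg_cov n u v d1 d2\<bar> else 0))"
    by (intro sum.cong refl) (simp add: pair_cov_def)
  also have "\<dots> = total_cov n d1 d2 + (\<Sum>u\<in>{1..t}. \<bar>deg_cov n u u d1 d2\<bar>)"
    by (simp add: sum.distrib total_cov_def n sum.delta)
  \<comment> \<open>The diagonal is at most twice a mean count, which is of the same order as the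
    bound for distinct nodes.\<close>
  also have "(\<Sum>u\<in>{1..t}. \<bar>deg_cov n u u d1 d2\<bar>) \<le> (\<Sum>u\<in>{1..t}. 2 * deg_prob n u d2)"
  proof (rule sum_mono)
    fix u
    have "deg_prob n u d2 * (1 - deg_prob n u d2) \<le> deg_prob n u d2"
      using deg_prob_nonneg[of n u d2] deg_prob_le_1[of n u d2] by (simp add: mult_left_le)
    then show "\<bar>deg_cov n u u d1 d2\<bar> \<le> 2 * deg_prob n u d2"
      using abs_deg_cov_le[of n u u d1 d2] by simp
  qed
  also have "\<dots> = 2 * mean_deg n d2"
    by (simp add: mean_deg_def n sum_distrib_left)
  also have "total_cov n d1 d2 + 2 * mean_deg n d2
      \<le> covC * N n * (h d1 + h d2) + 2 * (meanC * N n * h d2)"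
    using total_cov_le[OF n(1) assms(1,2)] mean_deg_le[OF n(1) assms(2)] by simp
  also have "\<dots> \<le> covC * N n * (h d1 + h d2) + 2 * (meanC * N n * (h d1 + h d2))"
    using meanC_ge_1 N_pos[of n] h_pos[of d1] by (intro add_left_mono mult_left_mono) auto
  finally show ?thesis
    by (simp add: covariance_num_degree n_def algebra_simps)
qed

end

theorem theorem2:
  fixes a :: real and k :: nat
  assumes "a > 0" and "k \<ge> 1"
  shows "\<exists>C::real. \<forall>d1 d2 t :: nat. d1 \<ge> k \<longrightarrow> d2 \<ge> k \<longrightarrow> t \<ge> 1 \<longrightarrow>
    \<bar>covariance (measure_pmf (bo_graph a k t))
       (\<lambda>G. real (num_degree d1 t G)) (\<lambda>G. real (num_degree d2 t G))\<bar>
    \<le> C * ((real d1 powr (- 2 - a) + real d2 powr (- 2 - a)) * real t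
            + inverse (real d1) * inverse (real d2))"
proof -
  interpret buckley_osthus a k
    using assms by unfold_locales
  define D where "D = covC + 2 * meanC"
  define C where "C = D * ((a + 1) * real k + a) * hC"
  have D: "D \<ge> 0" using covC_ge(3) meanC_ge_1 by (simp add: D_def)
  then have C: "C \<ge> 0" using a_pos hC_pos by (simp add: C_def)
  show ?thesis
  proof (intro exI[of _ C] allI impI)
    fix d1 d2 t :: nat assume *: "d1 \<ge> k" "d2 \<ge> k" "t \<ge> 1"
    let ?p = "real d1 powr (- 2 - a) + real d2 powr (- 2 - a)"
    \<comment> \<open>Since \<open>t \<ge> 1\<close>, the additive constant in
      \<open>N (k * t)\<close> is absorbed into a multiple of \<open>t\<close>.\<close>
    have "a * 1 \<le> a * real t" using a_pos * by (intro mult_left_mono) auto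
    then have N: "N (k * t) \<le> ((a + 1) * real k + a) * real t"
      by (simp add: pdenom_def algebra_simps)
    have "\<bar>covariance (measure_pmf (bo_graph a k t))
        (\<lambda>G. real (num_degree d1 t G)) (\<lambda>G. real (num_degree d2 t G))\<bar> \<le> D * N (k * t) * (h d1 + h d2)"
      unfolding D_def by (rule abs_covariance_num_degree_le[OF *])
    also have "\<dots> \<le> D * (((a + 1) * real k + a) * real t) * (hC * real d1 powr (- 2 - a) + hC * real d2 powr (- 2 - a))"
      using * D N a_pos h_pos[of d1] h_pos[of d2]
      by (intro mult_mono add_mono h_le mult_left_mono) auto
    also have "\<dots> = C * (?p * real t)"
      by (simp add: C_def algebra_simps)
    also have "\<dots> \<le> C * (?p * real t + inverse (real d1) * inverse (real d2))"
      using C by (intro mult_left_mono) auto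
    finally show "\<bar>covariance (measure_pmf (bo_graph a k t))
        (\<lambda>G. real (num_degree d1 t G)) (\<lambda>G. real (num_degree d2 t G))\<bar>
      \<le> C * (?p * real t + inverse (real d1) * inverse (real d2))" .
  qed
qed

end
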